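(* Let $\mathcal{S}_R$ be the submodule of $H^2(\mathbb{D}^2)$ consisting of those functions which have a zero of order at least $n$ at $(0,\alpha_n):=(0,1-n^{-3})$ for every $n\ge 1$. Then $\mathcal{S}_R\ominus(z_1\mathcal{S}_R+z_2\mathcal{S}_R)$ is a two-dimensional subspace given by $$\mathcal{S}_R\ominus(z_1\mathcal{S}_R+z_2\mathcal{S}_R)=\mathbb{C}\prod_{i=1}^{\infty}b_{\alpha_i}^i\ \oplus\ \mathbb{C}\prod_{i=2}^{\infty}b_{\alpha_i}^i .$$
   Context: $\mathbb{D}=\{z\in\mathbb{C}:|z|<1\}$, and $H^2(\mathbb{D}^2)=H^2(\mathbb{D})\otimes H^2(\mathbb{D})$ is the Hardy space over the bidisc with coordinates $(z_1,z_2)$. A submodule is a closed subspace invariant under multiplication by $z_1$ and $z_2$. For nonzero $\alpha\in\mathbb{D}$, $b_\alpha(z)=\frac{-\bar\alpha}{|\alpha|}\frac{z-\alpha}{1-\bar\alpha z}$, and $b_0(z)=z$ (here $\alpha_1=0$). The submodule $\mathcal{S}_R$ is a Rudin submodule: it equals $\bigvee_{n=0}^{\infty}\big(z^nH^2(\mathbb{D})\otimes\varphi_nH^2(\mathbb{D})\big)$, where $\bigvee$ denotes closed linear span, $\varphi_0=\prod_{i=1}^{\infty}b_{\alpha_i}^i$ and $\varphi_n=\varphi_{n-1}/\prod_{j=n}^{\infty}b_{\alpha_j}$ for $n\ge1$; the first tensor factor corresponds to the variable $z_1$ and the second to $z_2$. The Blaschke products in the displayed formula are functions of the second variable $z_2$.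 For a submodule $\mathcal{S}$, $\mathcal{S}\ominus(z_1\mathcal{S}+z_2\mathcal{S})$ denotes the set of vectors in $\mathcal{S}$ orthogonal to $z_1\mathcal{S}+z_2\mathcal{S}$.
   Formalization: The second generator is corrected from ∏_{i≥2} b_{α_i}^i to z_1 ∏_{i≥2} b_{α_i}^{i-1} (in z_2), i.e. z_1 φ_1: the printed product does not vanish at (0,α_1)=(0,0), so it is not in S_R and the printed equality is false. *)

theory Defs
  imports "HOL-Analysis.Analysis" "HOL-Library.Function_Algebras"
begin

definition bidisc :: "(complex \<times> complex) set" where
  "bidisc = ball 0 1 \<times> ball 0 1"

definition mixed_deriv ::
    "nat \<Rightarrow> nat \<Rightarrow> (complex \<times> complex \<Rightarrow> complex) \<Rightarrow> complex \<times> complex \<Rightarrow> complex" where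
  "mixed_deriv i j f p =
     (deriv ^^ i) (\<lambda>z1. (deriv ^^ j) (\<lambda>z2. f (z1, z2)) (snd p)) (fst p)"

definition taylor_coeff :: "(complex \<times> complex \<Rightarrow> complex) \<Rightarrow> nat \<times> nat \<Rightarrow> complex" where
  "taylor_coeff f k =
     mixed_deriv (fst k) (snd k) f (0, 0) / (fact (fst k) * fact (snd k))"

text \<open>
  The Hardy space of the bidisc: the functions on the bidisc that are the sum of their Taylor
  series at the origin, with square-summable coefficients. Functions are total in HOL, so a
  function on the bidisc is represented by its extension by zero; equality of elements of the
  Hardy space is then equality of functions.
\<close>

definition hardy_bidisc :: "(complex \<times> complex \<Rightarrow> complex) set" where
  "hardy_bidisc = {f.
     (\<lambda>k. (cmod (taylor_coeff f k))\<^sup>2) summable_on UNIV \<and>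
     (\<forall>p\<in>bidisc. ((\<lambda>k. taylor_coeff f k * fst p ^ fst k * snd p ^ snd k) has_sum f p) UNIV) \<and>
     (\<forall>p. p \<notin> bidisc \<longrightarrow> f p = 0)}"

definition hardy_inner ::
    "(complex \<times> complex \<Rightarrow> complex) \<Rightarrow> (complex \<times> complex \<Rightarrow> complex) \<Rightarrow> complex" where
  "hardy_inner f g = (\<Sum>\<^sub>\<infinity>k\<in>UNIV. taylor_coeff f k * cnj (taylor_coeff g k))"

definition zero_of_order_at_least ::
    "nat \<Rightarrow> (complex \<times> complex \<Rightarrow> complex) \<Rightarrow> complex \<times> complex \<Rightarrow> bool" where
  "zero_of_order_at_least n f p \<longleftrightarrow> (\<forall>i j. i + j < n \<longrightarrow> mixed_deriv i j f p = 0)"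

definition rudin_pt :: "nat \<Rightarrow> complex" where
  "rudin_pt n = 1 - 1 / of_nat n ^ 3"

definition rudin_submodule :: "(complex \<times> complex \<Rightarrow> complex) set" where
  "rudin_submodule =
     {f \<in> hardy_bidisc. \<forall>n\<ge>1. zero_of_order_at_least n f (0, rudin_pt n)}"

definition wandering ::
    "(complex \<times> complex \<Rightarrow> complex) set \<Rightarrow> (complex \<times> complex \<Rightarrow> complex) set" where
  "wandering S = {f \<in> S. \<forall>g\<in>S. \<forall>h\<in>S.
     hardy_inner f (\<lambda>p. fst p * g p + snd p * h p) = 0}"

definition blaschke_factor :: "complex \<Rightarrow> complex \<Rightarrow> complex" where
  "blaschke_factor a z =
     (if a = 0 then z
      else - cnj a / of_real (cmod a) * ((z - a) / (1 - cnj a * z)))"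

text \<open>
  The two generators. Since products over natural numbers start at 0, the indices are shifted:
  the first is the product over \<open>n \<ge> 1\<close> of the \<open>n\<close>-th powers of the Blaschke factors,
  as a function of the second variable. The second is \<open>z\<^sub>1\<close> times the product over
  \<open>n \<ge> 2\<close> of their \<open>(n - 1)\<close>-st powers.

  The source prints the second generator as the product over \<open>n \<ge> 2\<close> of the \<open>n\<close>-th powers,
  without the factor \<open>z\<^sub>1\<close>. That function does not vanish at \<open>(0, 0)\<close>, so it does not lie in
  the submodule. Here the misprint is corrected: the generator is \<open>z\<^sub>1 \<phi>\<^sub>1(z\<^sub>2)\<close>, where
  \<open>\<phi>\<^sub>1 = \<phi>\<^sub>0 / (b\<^sub>1 b\<^sub>2 b\<^sub>3 \<dots>)\<close> is the second function of the source's own sequence defining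
  the Rudin submodule.
\<close>

definition rudin_gen0 :: "complex \<times> complex \<Rightarrow> complex" where
  "rudin_gen0 p = (if p \<in> bidisc
     then \<Prod>i. blaschke_factor (rudin_pt (i + 1)) (snd p) ^ (i + 1) else 0)"

definition rudin_gen1 :: "complex \<times> complex \<Rightarrow> complex" where
  "rudin_gen1 p = (if p \<in> bidisc
     then fst p * (\<Prod>i. blaschke_factor (rudin_pt (i + 2)) (snd p) ^ (i + 1)) else 0)"

definition fun_scale :: "complex \<Rightarrow> ('a \<Rightarrow> complex) \<Rightarrow> 'a \<Rightarrow> complex" where
  "fun_scale c f = (\<lambda>x. c * f x)"

interpretation cfun: vector_space "fun_scale :: complex \<Rightarrow> ('a \<Rightarrow> complex) \<Rightarrow> 'a \<Rightarrow> complex"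
  by unfold_locales (auto simp: fun_scale_def fun_eq_iff algebra_simps)

end

theory Submission
  imports Defs "HOL-Complex_Analysis.Complex_Analysis"
begin

text \<open>
  Write a function on the bidisc as \<open>f = \<Sum>k. z\<^sub>1^k f\<^sub>k(z\<^sub>2)\<close>. A mixed derivative at a point
  \<open>(0, w)\<close> sees one row \<open>f\<^sub>k\<close> only, so the zero conditions decouple: \<open>f\<close> lies in the Rudin
  submodule iff, for every \<open>k\<close>, the row \<open>f\<^sub>k\<close> lies in the space \<open>M\<^sub>k\<close> of those functions in the
  Hardy space of the disc that vanish to order \<open>n - k\<close> at \<open>\<alpha>\<^sub>n\<close> for all \<open>n > k\<close>. Let
  \<open>\<phi>\<^sub>k\<close> be the Blaschke product with exactly these zeros.

  Everything rests on the identity \<open>M \<ominus> zM = \<complex>\<phi>\<close> for the space \<open>M\<close> of functions that have the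
  zeros of a convergent Blaschke product \<open>\<phi>\<close>. It is the conjunction of two facts.

  \<^item> \<open>\<phi> \<bottom> zM\<close> (\<open>product_orthogonal\<close>). Every \<open>h \<in> M\<close> is divisible by each finite partial product
    \<open>B\<close> of \<open>\<phi>\<close>, with quotient \<open>q\<close> again in the Hardy space, and multiplication by \<open>B\<close> is
    isometric; hence \<open>\<langle>B, zh\<rangle> = \<langle>B \<cdot> 1, B \<cdot> zq\<rangle> = \<langle>1, zq\<rangle> = 0\<close>. The partial products are
    unit vectors whose coefficients converge to those of \<open>\<phi>\<close>, so they converge weakly, and
    orthogonality to \<open>zh\<close> survives (\<open>h2_weak_limit\<close>).
  \<^item> \<open>M = \<complex>\<phi> + zM\<close> (\<open>zero_space_decomposition\<close>). A suitable multiple of \<open>\<phi>\<close> can be subtracted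
    from \<open>h \<in> M\<close> to raise the order of vanishing at \<open>0\<close> beyond that of \<open>\<phi>\<close>; the difference is
    then \<open>z\<close> times an element of \<open>M\<close>.

  Now let \<open>f\<close> be in the submodule \<open>S\<close> and orthogonal to \<open>z\<^sub>1 S + z\<^sub>2 S\<close>. Orthogonality to \<open>z\<^sub>2 S\<close>
  says \<open>f\<^sub>k \<bottom> z M\<^sub>k\<close>, so \<open>f\<^sub>k = c\<^sub>k \<phi>\<^sub>k\<close>. Orthogonality to \<open>z\<^sub>1 S\<close> says
  \<open>f\<^sub>k \<bottom> M\<^sub>k\<^sub>-\<^sub>1\<close> for \<open>k \<ge> 1\<close>. If \<open>k \<ge> 2\<close>, then \<open>\<phi>\<^sub>k\<^sub>-\<^sub>1\<close> lies in \<open>M\<^sub>k\<^sub>-\<^sub>1 \<subseteq> M\<^sub>k\<close> and does not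
  vanish at \<open>0\<close>; by the decomposition of \<open>M\<^sub>k\<close> it is not orthogonal to \<open>\<phi>\<^sub>k\<close>, which
  forces \<open>c\<^sub>k = 0\<close>. If \<open>k = 1\<close>, the condition is automatic, because \<open>\<alpha>\<^sub>1 = 0\<close> gives
  \<open>M\<^sub>0 \<subseteq> z M\<^sub>1\<close>. What remains is the span of \<open>\<phi>\<^sub>0\<close> and \<open>z\<^sub>1 \<phi>\<^sub>1\<close>.
\<close>

section \<open>The Hardy space of the disc as a space of power series\<close>

text \<open>
  Elements of the Hardy space of the disc are taken as formal power series rather than as
  functions: products, quotients and units then live in a commutative ring, and the inner
  product reads off coefficients. Values at points of the disc are recovered by \<^const>\<open>eval_fps\<close>.
\<close>

definition h2 :: "complex fps set" where
  "h2 = {A. summable (\<lambda>n. (cmod (fps_nth A n))\<^sup>2)}"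

definition h2_inner :: "complex fps \<Rightarrow> complex fps \<Rightarrow> complex" where
  "h2_inner A B = (\<Sum>n. fps_nth A n * cnj (fps_nth B n))"

lemma h2_L2_set_le:
  assumes "A \<in> h2" "finite I"
  shows "L2_set (\<lambda>n. cmod (fps_nth A n)) I \<le> sqrt (\<Sum>n. (cmod (fps_nth A n))\<^sup>2)"
  using assms by (auto simp: L2_set_def h2_def intro!: sum_le_suminf)

text \<open>
  The finite norms \<open>L2_set _ {..<N}\<close> obey the triangle inequality for arbitrary sequences, before
  square summability is known. A bound uniform in \<open>N\<close> is therefore the convenient way into the space.
\<close>

lemma h2I_L2_set_bounded:
  assumes "\<And>N. L2_set (\<lambda>n. cmod (fps_nth A n)) {..<N} \<le> K"
  shows "A \<in> h2"
proof -
  have "(\<Sum>n<N. (cmod (fps_nth A n))\<^sup>2) \<le> K\<^sup>2" for N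
  proof -
    have "(\<Sum>n<N. (cmod (fps_nth A n))\<^sup>2) = (L2_set (\<lambda>n. cmod (fps_nth A n)) {..<N})\<^sup>2"
      by (simp add: L2_set_def sum_nonneg)
    also have "\<dots> \<le> K\<^sup>2"
      by (intro power_mono assms) simp
    finally show ?thesis .
  qed
  then show ?thesis
    unfolding h2_def by (auto intro!: summableI_nonneg_bounded)
qed

lemma h2_cmod_coeff_le:
  assumes "A \<in> h2"
  shows "cmod (fps_nth A n) \<le> sqrt (\<Sum>n. (cmod (fps_nth A n))\<^sup>2)"
  using h2_L2_set_le[OF assms, of "{n}"] by simp

lemma h2_add [intro]:
  assumes "A \<in> h2" "B \<in> h2"
  shows "A + B \<in> h2"
proof (rule h2I_L2_set_bounded)
  fix N :: nat
  have "L2_set (\<lambda>n. cmod (fps_nth (A + B) n)) {..<N}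
      \<le> L2_set (\<lambda>n. cmod (fps_nth A n) + cmod (fps_nth B n)) {..<N}"
    by (intro L2_set_mono) (auto simp: norm_triangle_ineq)
  also have "\<dots> \<le> L2_set (\<lambda>n. cmod (fps_nth A n)) {..<N} + L2_set (\<lambda>n. cmod (fps_nth B n)) {..<N}"
    by (rule L2_set_triangle_ineq)
  also have "\<dots> \<le> sqrt (\<Sum>n. (cmod (fps_nth A n))\<^sup>2) + sqrt (\<Sum>n. (cmod (fps_nth B n))\<^sup>2)"
    by (intro add_mono h2_L2_set_le assms) auto
  finally show "L2_set (\<lambda>n. cmod (fps_nth (A + B) n)) {..<N}
      \<le> sqrt (\<Sum>n. (cmod (fps_nth A n))\<^sup>2) + sqrt (\<Sum>n. (cmod (fps_nth B n))\<^sup>2)" .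
qed

lemma h2_cmult [intro]: "A \<in> h2 \<Longrightarrow> fps_const c * A \<in> h2"
  by (auto simp: h2_def norm_mult power_mult_distrib intro: summable_mult)

lemma h2_diff [intro]: "A \<in> h2 \<Longrightarrow> B \<in> h2 \<Longrightarrow> A - B \<in> h2"
  using h2_add[of A "fps_const (-1) * B"] h2_cmult[of B "-1"]
  by (simp flip: fps_const_neg)

lemma h2_X_mult_iff: "fps_X * A \<in> h2 \<longleftrightarrow> A \<in> h2"
proof -
  have "summable (\<lambda>n. (cmod (fps_nth (fps_X * A) n))\<^sup>2)
      \<longleftrightarrow> summable (\<lambda>n. (cmod (fps_nth (fps_X * A) (Suc n)))\<^sup>2)"
    by (rule summable_Suc_iff[symmetric])
  then show ?thesis
    by (simp add: h2_def)
qed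

lemma h2_1 [intro, simp]: "1 \<in> h2"
  by (auto simp: h2_def intro!: summable_finite[of "{0}"] split: if_splits)

lemma h2_0 [intro, simp]: "0 \<in> h2"
  by (auto simp: h2_def)

lemma fps_conv_radius_h2:
  assumes "A \<in> h2"
  shows "fps_conv_radius A \<ge> 1"
  unfolding fps_conv_radius_def
proof (rule conv_radius_geI_ex')
  fix r :: real
  assume r: "0 < r" "ereal r < 1"
  define K where "K = sqrt (\<Sum>n. (cmod (fps_nth A n))\<^sup>2)"
  have "summable (\<lambda>n. K * r ^ n)"
    using r by (intro summable_mult summable_geometric) auto
  moreover have "norm (fps_nth A n * of_real r ^ n) \<le> K * r ^ n" for n
    using h2_cmod_coeff_le[OF assms] r
    by (auto simp: norm_mult norm_power K_def intro!: mult_right_mono)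
  ultimately show "summable (\<lambda>n. fps_nth A n * of_real r ^ n)"
    by (rule summable_comparison_test')
qed

lemma h2_in_conv_radius:
  assumes "A \<in> h2" "cmod z < 1"
  shows "ereal (cmod z) < fps_conv_radius A"
proof -
  have "ereal (cmod z) < 1"
    using assms by simp
  also have "\<dots> \<le> fps_conv_radius A"
    by (rule fps_conv_radius_h2) fact
  finally show ?thesis .
qed

lemma h2_inner_abs_summable:
  assumes "A \<in> h2" "B \<in> h2"
  shows "summable (\<lambda>n. norm (fps_nth A n * cnj (fps_nth B n)))"
proof (rule summable_comparison_test')
  show "summable (\<lambda>n. (cmod (fps_nth A n))\<^sup>2 + (cmod (fps_nth B n))\<^sup>2)"
    using assms by (auto simp: h2_def intro: summable_add)
  show "norm (norm (fps_nth A n * cnj (fps_nth B n))) \<le> (cmod (fps_nth A n))\<^sup>2 + (cmod (fps_nth B n))\<^sup>2" for n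
  proof -
    have "0 \<le> cmod (fps_nth A n) * cmod (fps_nth B n)"
      by simp
    then have "cmod (fps_nth A n) * cmod (fps_nth B n) \<le> (cmod (fps_nth A n))\<^sup>2 + (cmod (fps_nth B n))\<^sup>2"
      using sum_squares_bound[of "cmod (fps_nth A n)" "cmod (fps_nth B n)"] by linarith
    then show ?thesis
      by (simp add: norm_mult)
  qed
qed

lemma h2_inner_summable:
  "A \<in> h2 \<Longrightarrow> B \<in> h2 \<Longrightarrow> summable (\<lambda>n. fps_nth A n * cnj (fps_nth B n))"
  by (rule summable_norm_cancel) (rule h2_inner_abs_summable)

lemma h2_inner_diff_left:
  "A \<in> h2 \<Longrightarrow> B \<in> h2 \<Longrightarrow> C \<in> h2 \<Longrightarrow> h2_inner (A - B) C = h2_inner A C - h2_inner B C"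
  by (simp add: h2_inner_def suminf_diff h2_inner_summable left_diff_distrib)

lemma h2_inner_diff_right:
  "A \<in> h2 \<Longrightarrow> B \<in> h2 \<Longrightarrow> C \<in> h2 \<Longrightarrow> h2_inner C (A - B) = h2_inner C A - h2_inner C B"
  by (simp add: h2_inner_def suminf_diff h2_inner_summable right_diff_distrib)

lemma h2_inner_add_right:
  "A \<in> h2 \<Longrightarrow> B \<in> h2 \<Longrightarrow> C \<in> h2 \<Longrightarrow> h2_inner C (A + B) = h2_inner C A + h2_inner C B"
  by (simp add: h2_inner_def suminf_add h2_inner_summable distrib_left)

lemma h2_inner_cmult_left:
  "A \<in> h2 \<Longrightarrow> B \<in> h2 \<Longrightarrow> h2_inner (fps_const c * A) B = c * h2_inner A B"
  using suminf_mult[OF h2_inner_summable, of A B c]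
  by (simp add: h2_inner_def mult.assoc)

lemma h2_inner_cmult_right:
  "A \<in> h2 \<Longrightarrow> B \<in> h2 \<Longrightarrow> h2_inner A (fps_const c * B) = cnj c * h2_inner A B"
  using suminf_mult[OF h2_inner_summable, of A B "cnj c"]
  by (simp add: h2_inner_def algebra_simps)

lemma h2_inner_X_mult:
  assumes "A \<in> h2" "B \<in> h2"
  shows "h2_inner (fps_X * A) (fps_X * B) = h2_inner A B"
  using suminf_split_head[OF h2_inner_summable, of "fps_X * A" "fps_X * B"] assms
  by (simp add: h2_inner_def h2_X_mult_iff)

lemma h2_inner_self:
  assumes "A \<in> h2"
  shows "h2_inner A A = of_real (\<Sum>n. (cmod (fps_nth A n))\<^sup>2)"
  using assms by (auto simp: h2_inner_def h2_def suminf_of_real complex_norm_square[symmetric] simp del: of_real_power)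

lemma h2_inner_self_eq_0_iff:
  assumes "A \<in> h2"
  shows "h2_inner A A = 0 \<longleftrightarrow> A = 0"
proof -
  have "(\<Sum>n. (cmod (fps_nth A n))\<^sup>2) = 0 \<longleftrightarrow> (\<forall>n. (cmod (fps_nth A n))\<^sup>2 = 0)"
    using assms by (intro suminf_eq_zero_iff) (auto simp: h2_def)
  then show ?thesis
    using assms by (simp add: h2_inner_self fps_eq_iff)
qed

section \<open>Blaschke factors as isometries\<close>

text \<open>
  The geometric series for \<open>(1 - cz)\<^sup>-\<^sup>1\<close> acts on the Hardy space. From \<open>A = B + czA\<close> the norms of
  the first \<open>N\<close> coefficients satisfy \<open>\<parallel>A\<parallel> \<le> \<parallel>B\<parallel> + |c| \<parallel>A\<parallel>\<close>, and this can be solved for \<open>\<parallel>A\<parallel>\<close>.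
\<close>

lemma h2_geometric:
  assumes c: "cmod c < 1" and B: "B \<in> h2" and AB: "(1 - fps_const c * fps_X) * A = B"
  shows "A \<in> h2"
proof (rule h2I_L2_set_bounded)
  fix N :: nat
  let ?L = "\<lambda>f. L2_set f {..<N}"
  let ?s = "\<lambda>n. if n = 0 then 0 else cmod (fps_nth A (n - 1))"
  have rec: "fps_nth A n = fps_nth B n + (if n = 0 then 0 else c * fps_nth A (n - 1))" for n
    unfolding AB[symmetric] by (auto simp: left_diff_distrib mult.assoc)
  have "(\<Sum>n<N. (?s n)\<^sup>2) \<le> (\<Sum>n<N. (cmod (fps_nth A n))\<^sup>2)"
  proof (cases N)
    case (Suc M)
    have "(\<Sum>n<N. (?s n)\<^sup>2) = (\<Sum>n<M. (cmod (fps_nth A n))\<^sup>2)"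
      unfolding Suc sum.lessThan_Suc_shift by simp
    then show ?thesis
      by (simp add: Suc)
  qed simp
  then have shift: "?L ?s \<le> ?L (\<lambda>n. cmod (fps_nth A n))"
    by (simp add: L2_set_def)
  have "?L (\<lambda>n. cmod (fps_nth A n)) \<le> ?L (\<lambda>n. cmod (fps_nth B n) + cmod c * ?s n)"
    by (intro L2_set_mono, subst rec) (auto simp: norm_mult intro: order_trans[OF norm_triangle_ineq])
  also have "\<dots> \<le> ?L (\<lambda>n. cmod (fps_nth B n)) + ?L (\<lambda>n. cmod c * ?s n)"
    by (rule L2_set_triangle_ineq)
  also have "?L (\<lambda>n. cmod c * ?s n) = cmod c * ?L ?s"
    by (rule L2_set_right_distrib[symmetric]) simp
  also have "\<dots> \<le> cmod c * ?L (\<lambda>n. cmod (fps_nth A n))"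
    by (intro mult_left_mono shift) simp
  finally have "(1 - cmod c) * ?L (\<lambda>n. cmod (fps_nth A n)) \<le> ?L (\<lambda>n. cmod (fps_nth B n))"
    by (simp add: algebra_simps)
  also have "\<dots> \<le> sqrt (\<Sum>n. (cmod (fps_nth B n))\<^sup>2)"
    by (intro h2_L2_set_le B) simp
  finally show "?L (\<lambda>n. cmod (fps_nth A n)) \<le> sqrt (\<Sum>n. (cmod (fps_nth B n))\<^sup>2) / (1 - cmod c)"
    using c by (simp add: field_simps)
qed

text \<open>
  A zero in the disc can be divided out. The coefficients of the quotient are the tails
  \<open>q\<^sub>n = \<Sum>m. h\<^sub>n\<^sub>+\<^sub>1\<^sub>+\<^sub>m a^m\<close>, which satisfy \<open>q\<^sub>n = h\<^sub>n\<^sub>+\<^sub>1 + a q\<^sub>n\<^sub>+\<^sub>1\<close>; the vanishing of \<open>h\<close> at \<open>a\<close>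
  is what makes the constant coefficient come out right. This recursion runs upwards, so the norm
  of the first \<open>N\<close> coefficients of \<open>q\<close> is at most \<open>\<parallel>h\<parallel>\<close> plus \<open>|a|\<close> times itself plus a boundary
  term from \<open>q\<^sub>N\<close>, for which the bound by the geometric series is good enough.
\<close>

lemma h2_divide_linear:
  assumes a: "cmod a < 1" and H: "H \<in> h2" and zero: "eval_fps H a = 0"
  obtains Q where "Q \<in> h2" "H = (fps_X - fps_const a) * Q"
proof
  define Q where "Q = Abs_fps (\<lambda>n. \<Sum>m. fps_nth H (n + 1 + m) * a ^ m)"
  define K where "K = sqrt (\<Sum>n. (cmod (fps_nth H n))\<^sup>2)"
  have Hle: "cmod (fps_nth H n) \<le> K" for n
    unfolding K_def by (rule h2_cmod_coeff_le[OF H])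
  have geo: "summable (\<lambda>m. K * cmod a ^ m)"
    using a by (intro summable_mult summable_geometric) auto
  have le: "norm (fps_nth H (n + m) * a ^ m) \<le> K * cmod a ^ m" for n m
    using Hle by (auto simp: norm_mult norm_power intro!: mult_right_mono)
  have sm: "summable (\<lambda>m. fps_nth H (n + m) * a ^ m)" for n
    using le[of n] by (intro summable_comparison_test'[OF geo]) auto
  have split: "(\<Sum>m. fps_nth H (n + m) * a ^ m) = fps_nth H n + a * fps_nth Q n" for n
    using suminf_split_head[OF sm[of n]] suminf_mult[OF sm[of "n + 1"], of a]
    by (simp add: Q_def algebra_simps)
  have rec: "fps_nth Q n = fps_nth H (n + 1) + a * fps_nth Q (n + 1)" for n
    using split[of "n + 1"] by (simp add: Q_def)
  have "fps_nth H 0 + a * fps_nth Q 0 = 0"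
    using split[of 0] zero by (simp add: eval_fps_def)
  then have rec0: "fps_nth H 0 = - a * fps_nth Q 0"
    by (simp add: add_eq_0_iff2)
  show "H = (fps_X - fps_const a) * Q"
  proof (rule fps_ext)
    fix n show "fps_nth H n = fps_nth ((fps_X - fps_const a) * Q) n"
      using rec[of "n - 1"] rec0 by (cases n) (auto simp: algebra_simps)
  qed
  have Qle: "cmod (fps_nth Q n) \<le> K / (1 - cmod a)" for n
  proof -
    have "cmod (fps_nth Q n) \<le> (\<Sum>m. K * cmod a ^ m)"
      using le[of "n + 1"] by (auto simp: Q_def intro!: norm_suminf_le[OF _ geo])
    also have "\<dots> = K / (1 - cmod a)"
      using a by (simp add: suminf_mult suminf_geometric summable_geometric divide_inverse)
    finally show ?thesis .
  qed
  show "Q \<in> h2"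
  proof (rule h2I_L2_set_bounded)
    fix N :: nat
    let ?L = "\<lambda>f. L2_set f {..<N}"
    have "?L (\<lambda>n. cmod (fps_nth H (n + 1))) = L2_set (\<lambda>n. cmod (fps_nth H n)) (Suc ` {..<N})"
      by (simp add: L2_set_def sum.reindex)
    also have "\<dots> \<le> K"
      unfolding K_def by (intro h2_L2_set_le H) simp
    finally have 1: "?L (\<lambda>n. cmod (fps_nth H (n + 1))) \<le> K" .
    have "(\<Sum>n<N. (cmod (fps_nth Q (n + 1)))\<^sup>2) \<le> (\<Sum>n<Suc N. (cmod (fps_nth Q n))\<^sup>2)"
      unfolding sum.lessThan_Suc_shift by simp
    then have "?L (\<lambda>n. cmod (fps_nth Q (n + 1))) \<le> L2_set (\<lambda>n. cmod (fps_nth Q n)) {..<Suc N}"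
      by (simp add: L2_set_def)
    also have "\<dots> \<le> ?L (\<lambda>n. cmod (fps_nth Q n)) + cmod (fps_nth Q N)"
      unfolding lessThan_Suc
      by (simp add: L2_set_insert add.commute sqrt_sum_squares_le_sum)
    also have "\<dots> \<le> ?L (\<lambda>n. cmod (fps_nth Q n)) + K / (1 - cmod a)"
      using Qle by simp
    finally have 2: "?L (\<lambda>n. cmod (fps_nth Q (n + 1))) \<le> ?L (\<lambda>n. cmod (fps_nth Q n)) + K / (1 - cmod a)" .
    have "?L (\<lambda>n. cmod (fps_nth Q n)) \<le> ?L (\<lambda>n. cmod (fps_nth H (n + 1)) + cmod a * cmod (fps_nth Q (n + 1)))"
      by (intro L2_set_mono) (subst rec, auto simp: norm_mult intro: order_trans[OF norm_triangle_ineq])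
    also have "\<dots> \<le> ?L (\<lambda>n. cmod (fps_nth H (n + 1))) + ?L (\<lambda>n. cmod a * cmod (fps_nth Q (n + 1)))"
      by (rule L2_set_triangle_ineq)
    also have "?L (\<lambda>n. cmod a * cmod (fps_nth Q (n + 1))) = cmod a * ?L (\<lambda>n. cmod (fps_nth Q (n + 1)))"
      by (rule L2_set_right_distrib[symmetric]) simp
    also have "\<dots> \<le> cmod a * (?L (\<lambda>n. cmod (fps_nth Q n)) + K / (1 - cmod a))"
      by (intro mult_left_mono 2) simp
    also note 1
    finally have "(1 - cmod a) * ?L (\<lambda>n. cmod (fps_nth Q n)) \<le> K + cmod a * (K / (1 - cmod a))"
      by (simp add: algebra_simps)
    then show "?L (\<lambda>n. cmod (fps_nth Q n)) \<le> (K + cmod a * (K / (1 - cmod a))) / (1 - cmod a)"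
      using a by (simp add: pos_le_divide_eq mult.commute)
  qed
qed

text \<open>
  The power series of \<^const>\<open>blaschke_factor\<close>. With the unimodular factor set to \<open>1\<close> at \<open>a = 0\<close>, the
  general formula also covers the case of the factor \<open>z\<close>.
\<close>

definition fps_blaschke :: "complex \<Rightarrow> complex fps" where
  "fps_blaschke a = fps_const (if a = 0 then 1 else - cnj a / of_real (cmod a)) *
     ((fps_X - fps_const a) * inverse (1 - fps_const (cnj a) * fps_X))"

lemma fps_blaschke_0: "fps_blaschke 0 = fps_X"
  by (simp add: fps_blaschke_def)

lemma fps_mult_inverse_linear:
  "(1 - fps_const c * fps_X) * inverse (1 - fps_const c * fps_X) = (1 :: complex fps)"
  by (rule inverse_mult_eq_1') simp

lemma h2_inverse_linear_mult:
  assumes "cmod c < 1" "A \<in> h2"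
  shows "inverse (1 - fps_const c * fps_X) * A \<in> h2"
proof (rule h2_geometric[OF assms])
  show "(1 - fps_const c * fps_X) * (inverse (1 - fps_const c * fps_X) * A) = A"
    by (simp only: fps_mult_inverse_linear mult.assoc[symmetric] mult_1_left)
qed

lemma h2_linear_mult: "A \<in> h2 \<Longrightarrow> (fps_X - fps_const a) * A \<in> h2"
  by (simp add: left_diff_distrib h2_diff h2_X_mult_iff h2_cmult)

lemma h2_fps_blaschke_mult:
  assumes "cmod a < 1" "A \<in> h2"
  shows "fps_blaschke a * A \<in> h2"
  using assms unfolding fps_blaschke_def mult.assoc
  by (intro h2_cmult h2_linear_mult h2_inverse_linear_mult) auto

lemma eval_fps_blaschke:
  assumes a: "cmod a < 1" and z: "cmod z < 1"
  shows "eval_fps (fps_blaschke a) z = blaschke_factor a z"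
proof -
  define G where "G = inverse (1 - fps_const (cnj a) * fps_X :: complex fps)"
  define c where "c = (if a = 0 then 1 else - cnj a / of_real (cmod a))"
  have ne: "1 - cnj a * z \<noteq> 0"
  proof
    assume "1 - cnj a * z = 0"
    then have "cmod (cnj a * z) = 1"
      by simp
    moreover have "cmod (cnj a * z) < 1"
      using mult_strict_mono'[OF a z] by (simp add: norm_mult)
    ultimately show False by simp
  qed
  have G: "G \<in> h2"
    using h2_inverse_linear_mult[of "cnj a" 1] a by (simp add: G_def)
  have *: "(1 - cnj a * z) * eval_fps G z = 1"
  proof -
    have "eval_fps ((1 - fps_const (cnj a) * fps_X) * G) z
        = eval_fps (1 - fps_const (cnj a) * fps_X) z * eval_fps G z"
      using h2_in_conv_radius[OF G z]
      by (intro eval_fps_mult) (auto intro!: h2_in_conv_radius[OF _ z] simp: h2_diff h2_cmult h2_X_mult_iff[of 1, simplified])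
    also have "eval_fps (1 - fps_const (cnj a) * fps_X) z = 1 - cnj a * z"
      by (cases "a = 0") (simp_all add: eval_fps_diff eval_fps_mult fps_conv_radius_cmult_left)
    finally show ?thesis
      by (simp add: G_def fps_mult_inverse_linear)
  qed
  then have Gz: "eval_fps G z = 1 / (1 - cnj a * z)"
    using ne by (simp add: field_simps)
  have "eval_fps (fps_blaschke a) z = c * eval_fps ((fps_X - fps_const a) * G) z"
    unfolding fps_blaschke_def G_def[symmetric] c_def[symmetric]
    using h2_in_conv_radius[OF h2_linear_mult[OF G] z] by (subst eval_fps_mult) auto
  also have "eval_fps ((fps_X - fps_const a) * G) z = (z - a) * eval_fps G z"
    using h2_in_conv_radius[OF G z] h2_in_conv_radius[OF h2_linear_mult[of 1] z, simplified]
    by (subst eval_fps_mult) (auto simp: eval_fps_diff)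
  finally show ?thesis
    by (auto simp: blaschke_factor_def Gz c_def)
qed

text \<open>
  The identity \<open>|z - a| = |1 - cnj a z|\<close> on the unit circle in terms of inner products. Expanding both
  sides, the shift being isometric, leaves the same four terms.
\<close>

lemma h2_inner_linear_mult:
  assumes "A \<in> h2" "B \<in> h2"
  shows "h2_inner ((fps_X - fps_const a) * A) ((fps_X - fps_const a) * B)
       = h2_inner ((1 - fps_const (cnj a) * fps_X) * A) ((1 - fps_const (cnj a) * fps_X) * B)"
proof -
  have "fps_X * A \<in> h2" "fps_X * B \<in> h2"
    using assms by (simp_all add: h2_X_mult_iff)
  then show ?thesis
    using assms unfolding left_diff_distrib mult.assoc mult_1_left
    by (simp add: h2_inner_diff_left h2_inner_diff_right h2_diff h2_cmult
        h2_inner_cmult_left h2_inner_cmult_right h2_inner_X_mult right_diff_distrib)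
qed

text \<open>
  Apply the previous identity to \<open>A / (1 - cnj a z)\<close> and \<open>B / (1 - cnj a z)\<close>.
\<close>

lemma h2_inner_fps_blaschke_mult:
  assumes a: "cmod a < 1" and A: "A \<in> h2" and B: "B \<in> h2"
  shows "h2_inner (fps_blaschke a * A) (fps_blaschke a * B) = h2_inner A B"
proof -
  define G where "G = inverse (1 - fps_const (cnj a) * fps_X :: complex fps)"
  define c where "c = (if a = 0 then 1 else - cnj a / of_real (cmod a))"
  have GA: "G * A \<in> h2" and GB: "G * B \<in> h2"
    using a A B by (auto simp: G_def intro!: h2_inverse_linear_mult)
  have [simp]: "(1 - fps_const (cnj a) * fps_X) * (G * C) = C" for C
    unfolding G_def by (simp only: fps_mult_inverse_linear mult.assoc[symmetric] mult_1_left)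
  have "cmod c = 1"
    by (auto simp: c_def norm_divide)
  then have "c * cnj c = 1"
    using complex_norm_square[of c] by simp
  have "h2_inner (fps_blaschke a * A) (fps_blaschke a * B)
      = (c * cnj c) * h2_inner ((fps_X - fps_const a) * (G * A)) ((fps_X - fps_const a) * (G * B))"
    unfolding fps_blaschke_def G_def[symmetric] c_def[symmetric] mult.assoc
    using h2_linear_mult[OF GA] h2_linear_mult[OF GB]
    by (simp add: h2_inner_cmult_left h2_inner_cmult_right h2_cmult)
  also have "\<dots> = h2_inner A B"
    by (subst h2_inner_linear_mult[OF GA GB]) (simp add: \<open>c * cnj c = 1\<close>)
  finally show ?thesis .
qed

lemma h2_divide_fps_blaschke:
  assumes a: "cmod a < 1" and H: "H \<in> h2" and zero: "eval_fps H a = 0"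
  obtains Q where "Q \<in> h2" "H = fps_blaschke a * Q"
proof -
  define G where "G = inverse (1 - fps_const (cnj a) * fps_X :: complex fps)"
  define c where "c = (if a = 0 then 1 else - cnj a / of_real (cmod a))"
  obtain Q where Q: "Q \<in> h2" "H = (fps_X - fps_const a) * Q"
    using h2_divide_linear[OF assms] .
  define Q' where "Q' = fps_const (inverse c) * ((1 - fps_const (cnj a) * fps_X) * Q)"
  have "c \<noteq> 0"
    by (auto simp: c_def)
  show ?thesis
  proof (rule that[of Q'])
    show "Q' \<in> h2"
      using Q(1) unfolding Q'_def left_diff_distrib mult.assoc mult_1_left
      by (intro h2_cmult h2_diff) (simp_all add: h2_X_mult_iff)
    have "fps_blaschke a * Q' = (fps_const c * fps_const (inverse c)) * ((1 - fps_const (cnj a) * fps_X) * G)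
        * ((fps_X - fps_const a) * Q)"
      unfolding fps_blaschke_def Q'_def G_def[symmetric] c_def[symmetric] by (simp only: ac_simps)
    also have "\<dots> = H"
      using \<open>c \<noteq> 0\<close> Q by (simp add: G_def fps_mult_inverse_linear fps_const_mult)
    finally show "H = fps_blaschke a * Q'" ..
  qed
qed

section \<open>Orders of vanishing and finite Blaschke products\<close>

text \<open>
  Passing to the Taylor series at \<open>a\<close> turns the order of vanishing at \<open>a\<close> into divisibility by a
  power of the variable. The transformation is multiplicative, so that factors not vanishing at \<open>a\<close>
  become units and can be cancelled.
\<close>

definition fps_recenter :: "complex \<Rightarrow> complex fps \<Rightarrow> complex fps" where
  "fps_recenter a A = fps_expansion (eval_fps A) a"

definition vanishes_to :: "nat \<Rightarrow> complex fps \<Rightarrow> complex \<Rightarrow> bool" where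
  "vanishes_to n A a \<longleftrightarrow> fps_X ^ n dvd fps_recenter a A"

lemma fps_X_power_dvd_iff:
  fixes F :: "complex fps"
  shows "fps_X ^ n dvd F \<longleftrightarrow> (\<forall>j<n. fps_nth F j = 0)"
proof
  assume "fps_X ^ n dvd F"
  then show "\<forall>j<n. fps_nth F j = 0"
    by (auto simp: dvd_def fps_X_power_mult_nth)
next
  assume *: "\<forall>j<n. fps_nth F j = 0"
  have "F = fps_X ^ n * fps_shift n F"
    by (rule fps_ext) (use * in \<open>auto simp: fps_X_power_mult_nth\<close>)
  then show "fps_X ^ n dvd F"
    by (metis dvd_triv_left)
qed

lemma fps_nth_recenter: "fps_nth (fps_recenter a A) n = (deriv ^^ n) (eval_fps A) a / fact n"
  by (simp add: fps_recenter_def fps_expansion_def)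

lemma vanishes_to_iff_deriv: "vanishes_to n A a \<longleftrightarrow> (\<forall>j<n. (deriv ^^ j) (eval_fps A) a = 0)"
  by (simp add: vanishes_to_def fps_X_power_dvd_iff fps_nth_recenter)

lemma eval_fps_h2_mult:
  "A \<in> h2 \<Longrightarrow> B \<in> h2 \<Longrightarrow> cmod z < 1 \<Longrightarrow> eval_fps (A * B) z = eval_fps A z * eval_fps B z"
  by (intro eval_fps_mult h2_in_conv_radius)

lemma eval_fps_h2_analytic:
  assumes "A \<in> h2" "cmod a < 1"
  shows "eval_fps A analytic_on {a}"
  using h2_in_conv_radius[OF assms] by (intro analytic_on_eval_fps) (auto simp: in_eball_iff)

lemma eventually_in_disc: "cmod a < 1 \<Longrightarrow> eventually (\<lambda>z. cmod z < 1) (nhds a)"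
  using eventually_nhds_in_open[of "ball 0 1" a] by simp

lemma fps_recenter_mult:
  assumes "A \<in> h2" "B \<in> h2" "cmod a < 1"
  shows "fps_recenter a (A * B) = fps_recenter a A * fps_recenter a B"
proof -
  let ?f = "\<lambda>z. eval_fps A z * eval_fps B z"
  have "fps_recenter a (A * B) = fps_expansion ?f a"
    unfolding fps_recenter_def using eventually_in_disc[OF assms(3)]
    by (intro fps_expansion_cong) (auto elim!: eventually_mono simp: eval_fps_h2_mult assms)
  moreover have "(\<lambda>x. ?f (a + x)) has_fps_expansion fps_expansion ?f a"
    by (intro analytic_at_imp_has_fps_expansion analytic_on_mult eval_fps_h2_analytic assms)
  moreover have "(\<lambda>x. ?f (a + x)) has_fps_expansion fps_recenter a A * fps_recenter a B"
    unfolding fps_recenter_def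
    by (intro has_fps_expansion_mult analytic_at_imp_has_fps_expansion eval_fps_h2_analytic assms)
  ultimately show ?thesis
    using fps_expansion_unique_complex by metis
qed

lemma fps_recenter_diff:
  assumes "A \<in> h2" "B \<in> h2" "cmod a < 1"
  shows "fps_recenter a (A - B) = fps_recenter a A - fps_recenter a B"
proof -
  let ?f = "\<lambda>z. eval_fps A z - eval_fps B z"
  have "fps_recenter a (A - B) = fps_expansion ?f a"
    unfolding fps_recenter_def using eventually_in_disc[OF assms(3)]
    by (intro fps_expansion_cong)
       (auto elim!: eventually_mono simp: eval_fps_diff assms h2_in_conv_radius)
  moreover have "(\<lambda>x. ?f (a + x)) has_fps_expansion fps_expansion ?f a"
    by (intro analytic_at_imp_has_fps_expansion analytic_on_diff eval_fps_h2_analytic assms)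
  moreover have "(\<lambda>x. ?f (a + x)) has_fps_expansion fps_recenter a A - fps_recenter a B"
    unfolding fps_recenter_def
    by (intro has_fps_expansion_diff analytic_at_imp_has_fps_expansion eval_fps_h2_analytic assms)
  ultimately show ?thesis
    using fps_expansion_unique_complex by metis
qed

lemma fps_recenter_nth_0: "fps_nth (fps_recenter a A) 0 = eval_fps A a"
  by (simp add: fps_nth_recenter)

lemma fps_recenter_0 [simp]:
  assumes "A \<in> h2"
  shows "fps_recenter 0 A = A"
proof (rule fps_ext)
  fix n
  have "0 < fps_conv_radius A"
    using h2_in_conv_radius[OF assms, of 0] by (simp add: zero_ereal_def)
  then show "fps_nth (fps_recenter 0 A) n = fps_nth A n"
    by (simp add: fps_nth_recenter fps_nth_conv_deriv)
qed

lemma h2_fps_X_diff_const: "fps_X - fps_const a \<in> h2"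
  using h2_linear_mult[of 1 a] by simp

lemma fps_recenter_linear: "fps_recenter a (fps_X - fps_const a) = fps_X"
proof -
  have eq: "eval_fps (fps_X - fps_const a) = (\<lambda>z. z - a)"
    by (rule ext) (simp add: eval_fps_diff)
  have "(\<lambda>x. (a + x) - a) has_fps_expansion fps_expansion (\<lambda>z. z - a) a"
    by (rule analytic_at_imp_has_fps_expansion) (intro analytic_intros)
  then have "(\<lambda>x. x) has_fps_expansion fps_expansion (\<lambda>z. z - a) a"
    by simp
  then show ?thesis
    unfolding fps_recenter_def eq
    using fps_expansion_unique_complex has_fps_expansion_fps_X by metis
qed

lemma h2_fps_blaschke: "cmod a < 1 \<Longrightarrow> fps_blaschke a \<in> h2"
  using h2_fps_blaschke_mult[of a 1] by simp

lemma fps_recenter_blaschke: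
  assumes a: "cmod a < 1"
  obtains U where "fps_nth U 0 \<noteq> 0" "fps_recenter a (fps_blaschke a) = fps_X * U"
proof -
  define G where "G = inverse (1 - fps_const (cnj a) * fps_X :: complex fps)"
  define c where "c = (if a = 0 then 1 else - cnj a / of_real (cmod a))"
  have G: "G \<in> h2"
    using h2_inverse_linear_mult[of "cnj a" 1] a by (simp add: G_def)
  have L: "1 - fps_const (cnj a) * fps_X \<in> h2"
    using h2_X_mult_iff[of 1] by (auto intro!: h2_diff h2_cmult)
  have "eval_fps (1 - fps_const (cnj a) * fps_X) a * eval_fps G a = 1"
    using eval_fps_h2_mult[OF L G a] by (simp add: G_def fps_mult_inverse_linear)
  then have Ga: "eval_fps G a \<noteq> 0"
    by auto
  have cG: "fps_const c * G \<in> h2"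
    using G by (rule h2_cmult)
  have "eval_fps (fps_const c * G) a = c * eval_fps G a"
    using h2_in_conv_radius[OF G a] by (subst eval_fps_mult) auto
  then have "eval_fps (fps_const c * G) a \<noteq> 0"
    using Ga by (auto simp: c_def)
  moreover have "fps_blaschke a = (fps_X - fps_const a) * (fps_const c * G)"
    unfolding fps_blaschke_def G_def[symmetric] c_def[symmetric] by (simp only: ac_simps)
  then have "fps_recenter a (fps_blaschke a) = fps_X * fps_recenter a (fps_const c * G)"
    using fps_recenter_mult[OF h2_fps_X_diff_const cG a] by (simp add: fps_recenter_linear)
  ultimately show ?thesis
    using that[of "fps_recenter a (fps_const c * G)"] by (simp add: fps_recenter_nth_0)
qed

lemma vanishes_to_mult_iff:
  assumes "A \<in> h2" "B \<in> h2" "cmod a < 1" "eval_fps A a \<noteq> 0"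
  shows "vanishes_to n (A * B) a \<longleftrightarrow> vanishes_to n B a"
proof -
  have "fps_recenter a A dvd 1"
    using assms by (simp add: fps_recenter_nth_0)
  then have "fps_X ^ n dvd fps_recenter a B * fps_recenter a A \<longleftrightarrow> fps_X ^ n dvd fps_recenter a B"
    by (rule dvd_mult_unit_iff)
  then show ?thesis
    using assms by (simp add: vanishes_to_def fps_recenter_mult mult.commute)
qed

lemma vanishes_to_mult:
  assumes "A \<in> h2" "B \<in> h2" "cmod a < 1" "vanishes_to n B a"
  shows "vanishes_to n (A * B) a"
  using assms by (simp add: vanishes_to_def fps_recenter_mult)

lemma vanishes_to_diff:
  assumes "A \<in> h2" "B \<in> h2" "cmod a < 1" "vanishes_to n A a" "vanishes_to n B a"
  shows "vanishes_to n (A - B) a"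
  using assms by (simp add: vanishes_to_def fps_recenter_diff)

lemma vanishes_to_cmult:
  assumes "B \<in> h2" "cmod a < 1" "vanishes_to n B a"
  shows "vanishes_to n (fps_const c * B) a"
  using vanishes_to_mult[of "fps_const c" B] assms h2_cmult[of 1 c] by simp

lemma vanishes_to_mono: "vanishes_to n A a \<Longrightarrow> k \<le> n \<Longrightarrow> vanishes_to k A a"
  by (auto simp: vanishes_to_iff_deriv)

lemma vanishes_to_0 [simp]: "vanishes_to 0 A a"
  by (simp add: vanishes_to_def)

lemma vanishes_to_Suc_blaschke_iff:
  assumes a: "cmod a < 1" and B: "B \<in> h2"
  shows "vanishes_to (Suc n) (fps_blaschke a * B) a \<longleftrightarrow> vanishes_to n B a"
proof -
  obtain U where U: "fps_nth U 0 \<noteq> 0" "fps_recenter a (fps_blaschke a) = fps_X * U"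
    using fps_recenter_blaschke[OF a] .
  have "vanishes_to (Suc n) (fps_blaschke a * B) a
      \<longleftrightarrow> fps_X * fps_X ^ n dvd fps_X * (fps_recenter a B * U)"
    using fps_recenter_mult[OF h2_fps_blaschke[OF a] B a] U(2)
    by (simp add: vanishes_to_def mult_ac)
  also have "\<dots> \<longleftrightarrow> fps_X ^ n dvd fps_recenter a B * U"
    by (rule dvd_mult_cancel_left[THEN trans]) simp
  also have "\<dots> \<longleftrightarrow> fps_X ^ n dvd fps_recenter a B"
    using U(1) by (intro dvd_mult_unit_iff) simp
  finally show ?thesis
    by (simp add: vanishes_to_def)
qed

text \<open>
  These are the inner functions. The defining property used here is that multiplication by them is an
  isometry of the Hardy space.
\<close>

definition inner_fps :: "complex fps \<Rightarrow> bool" where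
  "inner_fps U \<longleftrightarrow> (\<forall>A\<in>h2. U * A \<in> h2) \<and>
     (\<forall>A\<in>h2. \<forall>B\<in>h2. h2_inner (U * A) (U * B) = h2_inner A B)"

lemma inner_fps_1: "inner_fps 1"
  by (simp add: inner_fps_def)

lemma inner_fps_mult: "inner_fps U \<Longrightarrow> inner_fps V \<Longrightarrow> inner_fps (U * V)"
  by (simp add: inner_fps_def mult.assoc)

lemma inner_fps_power: "inner_fps U \<Longrightarrow> inner_fps (U ^ n)"
  by (induction n) (auto intro: inner_fps_1 inner_fps_mult)

lemma inner_fps_prod: "(\<And>i. i \<in> I \<Longrightarrow> inner_fps (U i)) \<Longrightarrow> inner_fps (prod U I)"
  by (induction I rule: infinite_finite_induct) (auto intro: inner_fps_1 inner_fps_mult)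

lemma inner_fps_h2: "inner_fps U \<Longrightarrow> U \<in> h2"
  using h2_1 unfolding inner_fps_def by (metis mult_1_right)

lemma inner_fps_blaschke: "cmod a < 1 \<Longrightarrow> inner_fps (fps_blaschke a)"
  by (simp add: inner_fps_def h2_fps_blaschke_mult h2_inner_fps_blaschke_mult)

lemma inner_fps_norm: "inner_fps U \<Longrightarrow> h2_inner U U = 1"
proof -
  assume "inner_fps U"
  then have "h2_inner U U = h2_inner 1 1"
    using h2_1 unfolding inner_fps_def by (metis mult_1_right)
  also have "h2_inner 1 1 = (\<Sum>n\<in>{0::nat}. fps_nth (1::complex fps) n * cnj (fps_nth (1::complex fps) n))"
    unfolding h2_inner_def by (rule suminf_finite) auto
  finally show ?thesis
    by simp
qed

lemma divide_fps_blaschke_power: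
  assumes a: "cmod a < 1" and H: "H \<in> h2" and van: "vanishes_to n H a"
  shows "\<exists>Q\<in>h2. H = fps_blaschke a ^ n * Q"
  using H van
proof (induction n arbitrary: H)
  case (Suc n)
  have "eval_fps H a = 0"
    using Suc.prems(2) unfolding vanishes_to_iff_deriv by auto
  then obtain Q where Q: "Q \<in> h2" "H = fps_blaschke a * Q"
    using h2_divide_fps_blaschke[OF a Suc.prems(1)] by blast
  then have "vanishes_to n Q a"
    using Suc.prems(2) vanishes_to_Suc_blaschke_iff[OF a] by blast
  then obtain R where "R \<in> h2" "Q = fps_blaschke a ^ n * R"
    using Suc.IH[OF Q(1)] by blast
  then show ?case
    using Q by (auto simp: mult.assoc)
qed auto

lemma vanishes_to_fps_blaschke_power:
  assumes a: "cmod a < 1" and B: "B \<in> h2"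
  shows "vanishes_to n (fps_blaschke a ^ n * B) a"
proof (induction n)
  case (Suc n)
  have "fps_blaschke a ^ n * B \<in> h2"
    using inner_fps_power[OF inner_fps_blaschke[OF a]] B by (auto simp: inner_fps_def)
  then show ?case
    using Suc vanishes_to_Suc_blaschke_iff[OF a] by (simp add: mult.assoc)
qed auto

lemma eval_fps_blaschke_prod:
  assumes "\<And>i. i < (N::nat) \<Longrightarrow> cmod (\<alpha> i) < 1" "cmod z < 1"
  shows "eval_fps (\<Prod>i<N. fps_blaschke (\<alpha> i) ^ m i) z = (\<Prod>i<N. blaschke_factor (\<alpha> i) z ^ m i)"
  using assms(1)
proof (induction N)
  case (Suc N)
  let ?B = "fps_blaschke (\<alpha> N)"
  have inner: "inner_fps (\<Prod>i<N. fps_blaschke (\<alpha> i) ^ m i)" "inner_fps (?B ^ n)" for n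
    using Suc.prems by (auto intro!: inner_fps_prod inner_fps_power inner_fps_blaschke)
  have "eval_fps (?B ^ n) z = eval_fps ?B z ^ n" for n
    using h2_in_conv_radius[OF h2_fps_blaschke[OF Suc.prems[of N]] assms(2)]
    by (intro eval_fps_power) auto
  then show ?case
    using Suc assms(2) inner[THEN inner_fps_h2] eval_fps_h2_mult
    by (simp add: eval_fps_blaschke)
qed simp

lemma blaschke_factor_eq_0_iff:
  assumes "cmod a < 1" "cmod z < 1"
  shows "blaschke_factor a z = 0 \<longleftrightarrow> z = a"
proof -
  have "cmod (cnj a * z) < 1"
    using mult_strict_mono'[OF assms] by (simp add: norm_mult)
  then have "1 - cnj a * z \<noteq> 0"
    by (metis eq_iff_diff_eq_0 norm_one less_irrefl)
  then show ?thesis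
    by (auto simp: blaschke_factor_def)
qed

text \<open>
  Divide by one factor after the other. The zeros being distinct, the product of the factors already
  divided out does not vanish at the next zero, so the quotient keeps its full order there.
\<close>

lemma divide_fps_blaschke_prod:
  assumes "\<And>i. i < (N::nat) \<Longrightarrow> cmod (\<alpha> i) < 1" "inj \<alpha>" "H \<in> h2"
    and "\<And>i. i < N \<Longrightarrow> vanishes_to (m i) H (\<alpha> i)"
  shows "\<exists>Q\<in>h2. H = (\<Prod>i<N. fps_blaschke (\<alpha> i) ^ m i) * Q"
  using assms(1,4)
proof (induction N)
  case (Suc N)
  let ?P = "\<Prod>i<N. fps_blaschke (\<alpha> i) ^ m i"
  obtain Q where Q: "Q \<in> h2" "H = ?P * Q"
    using Suc.IH Suc.prems by auto
  have "inner_fps ?P"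
    using Suc.prems by (auto intro!: inner_fps_prod inner_fps_power inner_fps_blaschke)
  have "eval_fps ?P (\<alpha> N) = (\<Prod>i<N. blaschke_factor (\<alpha> i) (\<alpha> N) ^ m i)"
    using Suc.prems by (intro eval_fps_blaschke_prod) auto
  also have "\<dots> \<noteq> 0"
    using Suc.prems assms(2) by (auto simp: blaschke_factor_eq_0_iff inj_eq)
  finally have "vanishes_to (m N) Q (\<alpha> N)"
    using vanishes_to_mult_iff[OF inner_fps_h2[OF \<open>inner_fps ?P\<close>] Q(1)] Suc.prems Q(2) by auto
  then obtain R where "R \<in> h2" "Q = fps_blaschke (\<alpha> N) ^ m N * R"
    using divide_fps_blaschke_power Suc.prems(1) Q(1) by blast
  then show ?case
    using Q by (auto simp: mult.assoc)
qed (use assms in auto)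

section \<open>Infinite Blaschke products\<close>

lemma h2_disc_subset_eball: "A \<in> h2 \<Longrightarrow> ball 0 1 \<subseteq> eball 0 (fps_conv_radius A)"
  using ball_eball_mono[of 1 "fps_conv_radius A" 0] fps_conv_radius_h2[of A] by (simp add: one_ereal_def)

lemma h2_Cauchy_Schwarz:
  assumes "A \<in> h2" "B \<in> h2"
  shows "cmod (h2_inner A B) \<le> sqrt (\<Sum>n. (cmod (fps_nth A n))\<^sup>2) * sqrt (\<Sum>n. (cmod (fps_nth B n))\<^sup>2)"
proof -
  have "(\<Sum>n. norm (fps_nth A n * cnj (fps_nth B n)))
      \<le> sqrt (\<Sum>n. (cmod (fps_nth A n))\<^sup>2) * sqrt (\<Sum>n. (cmod (fps_nth B n))\<^sup>2)"
  proof (rule suminf_le_const[OF h2_inner_abs_summable[OF assms]])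
    fix K
    have "(\<Sum>n<K. norm (fps_nth A n * cnj (fps_nth B n)))
        = (\<Sum>n<K. \<bar>cmod (fps_nth A n)\<bar> * \<bar>cmod (fps_nth B n)\<bar>)"
      by (simp add: norm_mult)
    also have "\<dots> \<le> L2_set (\<lambda>n. cmod (fps_nth A n)) {..<K} * L2_set (\<lambda>n. cmod (fps_nth B n)) {..<K}"
      by (rule L2_set_mult_ineq)
    also have "\<dots> \<le> sqrt (\<Sum>n. (cmod (fps_nth A n))\<^sup>2) * sqrt (\<Sum>n. (cmod (fps_nth B n))\<^sup>2)"
      using assms by (intro mult_mono h2_L2_set_le) (auto simp: h2_def suminf_nonneg)
    finally show "(\<Sum>n<K. norm (fps_nth A n * cnj (fps_nth B n)))
      \<le> sqrt (\<Sum>n. (cmod (fps_nth A n))\<^sup>2) * sqrt (\<Sum>n. (cmod (fps_nth B n))\<^sup>2)" .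
  qed
  then show ?thesis
    unfolding h2_inner_def using summable_norm[OF h2_inner_abs_summable[OF assms]] by linarith
qed

lemma h2_shift:
  assumes "A \<in> h2"
  shows "fps_shift K A \<in> h2"
    and "(\<Sum>n. (cmod (fps_nth (fps_shift K A) n))\<^sup>2)
       = (\<Sum>n. (cmod (fps_nth A n))\<^sup>2) - (\<Sum>n<K. (cmod (fps_nth A n))\<^sup>2)"
proof -
  have *: "summable (\<lambda>n. (cmod (fps_nth A n))\<^sup>2)"
    using assms by (simp add: h2_def)
  show "fps_shift K A \<in> h2"
    using summable_ignore_initial_segment[OF *, of K] by (simp add: h2_def)
  show "(\<Sum>n. (cmod (fps_nth (fps_shift K A) n))\<^sup>2)
       = (\<Sum>n. (cmod (fps_nth A n))\<^sup>2) - (\<Sum>n<K. (cmod (fps_nth A n))\<^sup>2)"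
    using suminf_minus_initial_segment[OF *, of K] by simp
qed

text \<open>
  Unit vectors that converge coefficientwise converge weakly. If all of them are orthogonal to \<open>H\<close>,
  then for each of them the first \<open>K\<close> terms of the inner product with \<open>H\<close> are the negative of the
  remaining ones and hence at most the norm of the tail of \<open>H\<close>. This bound passes to the limit for
  fixed \<open>K\<close>, and then the tail is made small.
\<close>

lemma h2_weak_limit:
  assumes F: "\<And>N. F N \<in> h2" and norm: "\<And>N. h2_inner (F N) (F N) = 1"
    and lim: "\<And>n. (\<lambda>N. fps_nth (F N) n) \<longlonglongrightarrow> fps_nth \<Phi> n"
  shows h2_weak_limit_in_h2: "\<Phi> \<in> h2"
    and h2_weak_limit_orthogonal:
      "\<And>H. H \<in> h2 \<Longrightarrow> (\<And>N. h2_inner (F N) H = 0) \<Longrightarrow> h2_inner \<Phi> H = 0"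
proof -
  have norm1: "(\<Sum>n. (cmod (fps_nth (F N) n))\<^sup>2) = 1" for N
    using norm[of N] unfolding h2_inner_self[OF F] by (simp only: of_real_eq_1_iff)
  show \<Phi>: "\<Phi> \<in> h2"
  proof (rule h2I_L2_set_bounded)
    fix K
    have "(\<lambda>N. L2_set (\<lambda>n. cmod (fps_nth (F N) n)) {..<K}) \<longlonglongrightarrow> L2_set (\<lambda>n. cmod (fps_nth \<Phi> n)) {..<K}"
      unfolding L2_set_def by (intro tendsto_intros lim)
    then show "L2_set (\<lambda>n. cmod (fps_nth \<Phi> n)) {..<K} \<le> 1"
      using h2_L2_set_le[OF F, of "{..<K}"] norm1
      by (intro LIMSEQ_le_const2) auto
  qed
  fix H
  assume H: "H \<in> h2" and orth: "\<And>N. h2_inner (F N) H = 0"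
  define t where "t = (\<lambda>K. sqrt (\<Sum>n. (cmod (fps_nth (fps_shift K H) n))\<^sup>2))"
  \<comment> \<open>By orthogonality the head of the inner product is the negative of its tail, to which the
    Cauchy-Schwarz inequality applies.\<close>
  have head: "cmod (\<Sum>n<K. fps_nth (F N) n * cnj (fps_nth H n)) \<le> t K" for K N
  proof -
    have "0 = h2_inner (fps_shift K (F N)) (fps_shift K H) + (\<Sum>n<K. fps_nth (F N) n * cnj (fps_nth H n))"
      using suminf_split_initial_segment[OF h2_inner_summable[OF F H], of N K] orth[of N]
      by (simp add: h2_inner_def)
    then have "cmod (\<Sum>n<K. fps_nth (F N) n * cnj (fps_nth H n)) = cmod (h2_inner (fps_shift K (F N)) (fps_shift K H))"
      by (metis add_eq_0_iff norm_minus_cancel)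
    also have "\<dots> \<le> sqrt (\<Sum>n. (cmod (fps_nth (fps_shift K (F N)) n))\<^sup>2) * t K"
      unfolding t_def by (intro h2_Cauchy_Schwarz h2_shift(1) F H)
    also have "\<dots> \<le> 1 * t K"
    proof (rule mult_right_mono)
      show "sqrt (\<Sum>n. (cmod (fps_nth (fps_shift K (F N)) n))\<^sup>2) \<le> 1"
        unfolding h2_shift(2)[OF F] norm1 by (simp add: sum_nonneg)
      show "0 \<le> t K"
        unfolding t_def using h2_shift(1)[OF H] by (auto simp: h2_def intro!: suminf_nonneg)
    qed
    finally show ?thesis by simp
  qed
  have head\<Phi>: "cmod (\<Sum>n<K. fps_nth \<Phi> n * cnj (fps_nth H n)) \<le> t K" for K
  proof (rule LIMSEQ_le_const2)
    show "(\<lambda>N. cmod (\<Sum>n<K. fps_nth (F N) n * cnj (fps_nth H n)))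
        \<longlonglongrightarrow> cmod (\<Sum>n<K. fps_nth \<Phi> n * cnj (fps_nth H n))"
      by (intro tendsto_intros lim)
  qed (use head in auto)
  have "(\<lambda>K. (\<Sum>n. (cmod (fps_nth H n))\<^sup>2) - (\<Sum>n<K. (cmod (fps_nth H n))\<^sup>2)) \<longlonglongrightarrow>
      (\<Sum>n. (cmod (fps_nth H n))\<^sup>2) - (\<Sum>n. (cmod (fps_nth H n))\<^sup>2)"
    using H by (intro tendsto_intros summable_LIMSEQ) (simp add: h2_def)
  then have "t \<longlonglongrightarrow> sqrt ((\<Sum>n. (cmod (fps_nth H n))\<^sup>2) - (\<Sum>n. (cmod (fps_nth H n))\<^sup>2))"
    unfolding t_def h2_shift(2)[OF H] by (rule tendsto_real_sqrt)
  moreover have "(\<lambda>K. cmod (\<Sum>n<K. fps_nth \<Phi> n * cnj (fps_nth H n))) \<longlonglongrightarrow> cmod (h2_inner \<Phi> H)"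
    unfolding h2_inner_def by (intro tendsto_norm summable_LIMSEQ h2_inner_summable \<Phi> H)
  ultimately have "cmod (h2_inner \<Phi> H) \<le> sqrt ((\<Sum>n. (cmod (fps_nth H n))\<^sup>2) - (\<Sum>n. (cmod (fps_nth H n))\<^sup>2))"
    using head\<Phi> by (intro LIMSEQ_le) auto
  then show "h2_inner \<Phi> H = 0"
    by simp
qed

lemma cmod_blaschke_factor_le_1:
  assumes "cmod a < 1" "cmod z < 1"
  shows "cmod (blaschke_factor a z) \<le> 1"
proof -
  have "cmod ((z - a) / (1 - cnj a * z)) < 1"
    using Moebius_function_norm_lt_1[OF assms, of 0] by (simp add: Moebius_function_simple)
  then show ?thesis
    using assms by (simp add: blaschke_factor_def norm_mult norm_divide)
qed

text \<open>
  This estimate makes the infinite product converge. With \<open>u = cnj a / |a|\<close> one has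
  \<open>b\<^sub>a(z) - 1 = -(1 - |a|) (1 + uz) / (1 - cnj a z)\<close>, where the numerator is at most \<open>2\<close> and the
  denominator at least \<open>1 - r\<close> in modulus.
\<close>

lemma cmod_one_minus_blaschke_factor_le:
  assumes a: "cmod a < 1" and z: "cmod z \<le> r" and r: "r < 1"
  shows "cmod (blaschke_factor a z - 1) \<le> (1 - cmod a) * (2 / (1 - r))"
proof (cases "a = 0")
  case True
  have "0 \<le> r"
    using z norm_ge_zero order_trans by blast
  have "cmod (z - 1) \<le> cmod z + 1"
    using norm_triangle_ineq4[of z 1] by simp
  also have "\<dots> \<le> 2 / 1"
    using z r by simp
  also have "\<dots> \<le> 2 / (1 - r)"
    using r \<open>0 \<le> r\<close> by (intro divide_left_mono) auto
  finally show ?thesis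
    using True by (simp add: blaschke_factor_def)
next
  case False
  define u where "u = cnj a / of_real (cmod a)"
  define d where "d = 1 - cnj a * z"
  have u: "cmod u = 1"
    using False by (simp add: u_def norm_divide)
  have ca: "cnj a = of_real (cmod a) * u"
    using False by (simp add: u_def)
  \<comment> \<open>Both \<open>cnj a\<close> and \<open>|a|\<close> become multiples of \<open>u\<close>, which makes the numerator factor.\<close>
  have ua: "u * a = of_real (cmod a)"
    using complex_norm_square[of a] False by (simp add: u_def field_simps power2_eq_square)
  have "cmod (cnj a * z) \<le> 1 * r"
    unfolding norm_mult using a z by (intro mult_mono) auto
  then have d: "1 - r \<le> cmod d"
    using norm_triangle_ineq2[of 1 "cnj a * z"] by (simp add: d_def)
  then have d0: "d \<noteq> 0"
    using r by auto
  have "blaschke_factor a z = - u * ((z - a) / d)"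
    using False by (simp add: blaschke_factor_def u_def d_def)
  then have "blaschke_factor a z - 1 = - (u * (z - a) + d) / d"
    using d0 by (simp add: field_simps)
  also have "u * (z - a) + d = of_real (1 - cmod a) * (1 + u * z)"
    by (simp add: d_def ca ua[symmetric] algebra_simps)
  finally have "cmod (blaschke_factor a z - 1) = (1 - cmod a) * (cmod (1 + u * z) / cmod d)"
    using a by (simp add: norm_mult norm_divide del: of_real_diff)
  also have "\<dots> \<le> (1 - cmod a) * (2 / (1 - r))"
  proof (intro mult_left_mono frac_le)
    show "cmod (1 + u * z) \<le> 2"
      using norm_triangle_ineq[of 1 "u * z"] u z r by (simp add: norm_mult)
  qed (use a r d in auto)
  finally show ?thesis .
qed

definition blaschke_product :: "(nat \<Rightarrow> complex) \<Rightarrow> (nat \<Rightarrow> nat) \<Rightarrow> complex \<Rightarrow> complex" where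
  "blaschke_product \<alpha> m z = (\<Prod>i. blaschke_factor (\<alpha> i) z ^ m i)"

definition fps_blaschke_product :: "(nat \<Rightarrow> complex) \<Rightarrow> (nat \<Rightarrow> nat) \<Rightarrow> complex fps" where
  "fps_blaschke_product \<alpha> m = fps_expansion (blaschke_product \<alpha> m) 0"

text \<open>
  The space \<open>M\<close> of the introduction, for the zeros \<open>\<alpha> i\<close> with multiplicities \<open>m i\<close>. A multiplicity
  may be \<open>0\<close>, which allows single zeros to be removed from a sequence.
\<close>

definition zero_space :: "(nat \<Rightarrow> complex) \<Rightarrow> (nat \<Rightarrow> nat) \<Rightarrow> complex fps set" where
  "zero_space \<alpha> m = {H \<in> h2. \<forall>i. vanishes_to (m i) H (\<alpha> i)}"

lemma zero_space_h2: "A \<in> zero_space \<alpha> m \<Longrightarrow> A \<in> h2"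
  by (simp add: zero_space_def)

locale blaschke_sequence =
  fixes \<alpha> :: "nat \<Rightarrow> complex" and m :: "nat \<Rightarrow> nat"
  assumes in_disc: "cmod (\<alpha> i) < 1"
    and inj: "inj \<alpha>"
    and summable: "summable (\<lambda>i. real (m i) * (1 - cmod (\<alpha> i)))"
begin

abbreviation partial :: "nat \<Rightarrow> complex fps" where
  "partial N \<equiv> \<Prod>i<N. fps_blaschke (\<alpha> i) ^ m i"

abbreviation \<Phi> :: "complex fps" where
  "\<Phi> \<equiv> fps_blaschke_product \<alpha> m"

lemma inner_partial: "inner_fps (partial N)"
  by (intro inner_fps_prod inner_fps_power inner_fps_blaschke in_disc)

text \<open>
  On the unit disc \<open>|b^m - 1| \<le> m |b - 1|\<close>, so multiplicities cost no more than a factor \<open>m\<close>, and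
  \<open>\<Sum>i. m i * (1 - |\<alpha> i|) < \<infinity>\<close> is the right condition for convergence.
\<close>

lemma factor_minus_1_le:
  assumes "cmod z \<le> r" "r < 1"
  shows "cmod (blaschke_factor (\<alpha> i) z ^ m i - 1) \<le> real (m i) * (1 - cmod (\<alpha> i)) * (2 / (1 - r))"
proof -
  have "cmod (blaschke_factor (\<alpha> i) z ^ m i - 1 ^ m i) \<le> m i * cmod (blaschke_factor (\<alpha> i) z - 1)"
    using assms by (intro norm_power_diff cmod_blaschke_factor_le_1 in_disc) auto
  also have "\<dots> \<le> m i * ((1 - cmod (\<alpha> i)) * (2 / (1 - r)))"
    by (intro mult_left_mono cmod_one_minus_blaschke_factor_le in_disc assms) simp
  finally show ?thesis
    by (simp add: mult.assoc)
qed

lemma convergent: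
  assumes "cmod z < 1"
  shows "convergent_prod (\<lambda>i. blaschke_factor (\<alpha> i) z ^ m i)"
proof (rule abs_convergent_prod_imp_convergent_prod, rule summable_imp_abs_convergent_prod)
  show "summable (\<lambda>i. norm (blaschke_factor (\<alpha> i) z ^ m i - 1))"
    by (rule summable_comparison_test'[OF summable_mult2[OF summable, of "2 / (1 - cmod z)"]])
       (use assms factor_minus_1_le[of z "cmod z"] in auto)
qed

lemma nonzero:
  assumes "cmod z < 1" "\<And>i. m i \<noteq> 0 \<Longrightarrow> \<alpha> i \<noteq> z"
  shows "blaschke_product \<alpha> m z \<noteq> 0"
  unfolding blaschke_product_def
proof (rule prodinf_nonzero[OF convergent[OF assms(1)]])
  fix i
  show "blaschke_factor (\<alpha> i) z ^ m i \<noteq> 0"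
    using assms(2)[of i] by (auto simp: blaschke_factor_eq_0_iff[OF in_disc assms(1)])
qed

lemma uniform_limit_partial:
  assumes r: "r < 1"
  shows "uniform_limit (cball 0 r) (\<lambda>N. eval_fps (partial N)) (blaschke_product \<alpha> m) sequentially"
proof -
  let ?f = "\<lambda>i z. blaschke_factor (\<alpha> i) z ^ m i"
  have "uniformly_convergent_on (cball 0 r) (\<lambda>N z. \<Prod>i<N. ?f i z)"
  proof (rule uniformly_convergent_on_prod')
    show "continuous_on (cball 0 r) (?f i)" for i
    proof -
      have "cball 0 r \<subseteq> eball 0 (fps_conv_radius (fps_blaschke (\<alpha> i)))"
        using h2_disc_subset_eball[OF h2_fps_blaschke[OF in_disc]] r by fastforce
      then have "continuous_on (cball 0 r) (\<lambda>z. eval_fps (fps_blaschke (\<alpha> i)) z ^ m i)"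
        by (intro continuous_on_power) (rule continuous_on_subset[OF continuous_on_eval_fps])
      then show ?thesis
        by (rule continuous_on_eq) (use r in \<open>auto simp: eval_fps_blaschke in_disc\<close>)
    qed
    show "uniformly_convergent_on (cball 0 r) (\<lambda>N z. \<Sum>i<N. norm (?f i z - 1))"
      by (rule Weierstrass_m_test'[OF _ summable_mult2[OF summable, of "2 / (1 - r)"]])
         (use r factor_minus_1_le in auto)
  qed auto
  then have *: "uniform_limit (cball 0 r) (\<lambda>N z. \<Prod>i<N. ?f i z) (\<lambda>z. lim (\<lambda>N. \<Prod>i<N. ?f i z)) sequentially"
    by (simp add: uniformly_convergent_uniform_limit_iff)
  have "lim (\<lambda>N. \<Prod>i<N. ?f i z) = blaschke_product \<alpha> m z" if "z \<in> cball 0 r" for z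
  proof (rule limI)
    have "(\<lambda>N. \<Prod>i\<le>N. ?f i z) \<longlonglongrightarrow> blaschke_product \<alpha> m z"
      unfolding blaschke_product_def using that r by (intro convergent_prod_LIMSEQ convergent) auto
    then show "(\<lambda>N. \<Prod>i<N. ?f i z) \<longlonglongrightarrow> blaschke_product \<alpha> m z"
      by (simp add: LIMSEQ_lessThan_iff_atMost)
  qed
  then show ?thesis
    using r by (intro uniform_limit_cong[THEN iffD1, OF _ _ *])
      (auto simp: eval_fps_blaschke_prod in_disc)
qed

lemma holomorphic_partial: "eval_fps (partial N) holomorphic_on ball 0 1"
  by (intro holomorphic_on_eval_fps h2_disc_subset_eball inner_fps_h2 inner_partial)

lemma holomorphic_product: "blaschke_product \<alpha> m holomorphic_on ball 0 1"
proof (rule holomorphic_uniform_sequence[OF open_ball holomorphic_partial])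
  fix z :: complex
  assume z: "z \<in> ball 0 1"
  define d where "d = (1 - cmod z) / 2"
  have sub: "cball z d \<subseteq> cball 0 (cmod z + d)"
    by (auto simp: dist_norm) (metis add.commute add_le_cancel_left norm_minus_commute norm_triangle_sub order_trans)
  have "cmod z + d < 1"
    using z by (simp add: d_def field_simps)
  then have "uniform_limit (cball z d) (\<lambda>N. eval_fps (partial N)) (blaschke_product \<alpha> m) sequentially"
    using uniform_limit_on_subset[OF uniform_limit_partial sub] by simp
  moreover have "cball z d \<subseteq> ball 0 1"
    using sub \<open>cmod z + d < 1\<close> by (auto simp: dist_norm subset_eq)
  moreover have "0 < d"
    using z by (simp add: d_def)
  ultimately show "\<exists>d>0. cball z d \<subseteq> ball 0 1 \<and>
      uniform_limit (cball z d) (\<lambda>N. eval_fps (partial N)) (blaschke_product \<alpha> m) sequentially"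
    by blast
qed

lemma eval_fps_product:
  assumes "cmod z < 1"
  shows "eval_fps \<Phi> z = blaschke_product \<alpha> m z"
  unfolding fps_blaschke_product_def
  using eval_fps_expansion'[of "blaschke_product \<alpha> m" 0 1 z] holomorphic_product assms
  by (simp add: one_ereal_def)

lemma fps_nth_partial_tendsto: "(\<lambda>N. fps_nth (partial N) n) \<longlonglongrightarrow> fps_nth \<Phi> n"
proof -
  have "uniform_limit (ball 0 (1/2)) (\<lambda>N. eval_fps (partial N)) (blaschke_product \<alpha> m) sequentially"
    using uniform_limit_partial[of "1/2"] by (rule uniform_limit_on_subset) auto
  moreover have "\<forall>\<^sub>F N in sequentially. eval_fps (partial N) holomorphic_on ball 0 (1/2)"
    by (intro always_eventually allI holomorphic_on_subset[OF holomorphic_partial]) auto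
  ultimately have "(\<lambda>N. (deriv ^^ n) (eval_fps (partial N)) 0) \<longlonglongrightarrow> (deriv ^^ n) (blaschke_product \<alpha> m) 0"
    by (rule higher_deriv_complex_uniform_limit) auto
  then have "(\<lambda>N. (deriv ^^ n) (eval_fps (partial N)) 0 / fact n)
      \<longlonglongrightarrow> (deriv ^^ n) (blaschke_product \<alpha> m) 0 / fact n"
    by (intro tendsto_intros) auto
  moreover have "fps_nth (partial N) n = (deriv ^^ n) (eval_fps (partial N)) 0 / fact n" for N
    using fps_nth_recenter[of 0 "partial N" n] fps_recenter_0[OF inner_fps_h2[OF inner_partial]] by simp
  ultimately show ?thesis
    by (simp add: fps_blaschke_product_def fps_expansion_def)
qed

lemma product_h2: "\<Phi> \<in> h2"
  by (rule h2_weak_limit_in_h2[of partial])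
     (auto intro: inner_fps_h2 inner_fps_norm inner_partial fps_nth_partial_tendsto)

text \<open>
  For the partial products this follows from the isometry and \<open>\<langle>1, zq\<rangle> = 0\<close>; the product is their
  weak limit.
\<close>

lemma product_orthogonal:
  assumes "H \<in> zero_space \<alpha> m"
  shows "h2_inner \<Phi> (fps_X * H) = 0"
proof (rule h2_weak_limit_orthogonal[of partial])
  fix N
  obtain Q where Q: "Q \<in> h2" "H = partial N * Q"
    using divide_fps_blaschke_prod[of N \<alpha> H m] assms in_disc inj unfolding zero_space_def by auto
  have "h2_inner (partial N) (fps_X * H) = h2_inner (partial N * 1) (partial N * (fps_X * Q))"
    by (simp add: Q mult_ac)
  also have "\<dots> = h2_inner 1 (fps_X * Q)"
    using inner_partial Q h2_X_mult_iff h2_1 unfolding inner_fps_def by blast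
  also have "\<dots> = (\<Sum>n. 0)"
    unfolding h2_inner_def by (rule suminf_cong) simp
  finally show "h2_inner (partial N) (fps_X * H) = 0"
    by simp
qed (use assms in \<open>auto simp: zero_space_def h2_X_mult_iff
       intro: inner_fps_h2 inner_fps_norm inner_partial fps_nth_partial_tendsto\<close>)

lemma remove_zero: "blaschke_sequence \<alpha> (m(i := 0))"
proof
  show "summable (\<lambda>j. real ((m(i := 0)) j) * (1 - cmod (\<alpha> j)))"
    by (rule summable_comparison_test'[OF summable]) (auto simp: zero_le_mult_iff in_disc less_imp_le)
qed (fact in_disc inj)+

text \<open>
  Isolating one zero shows that the product has exactly the prescribed order there, because the
  remaining product is again of the same kind and does not vanish at that point.
\<close>

lemma product_factorization:
  "\<Phi> = fps_blaschke (\<alpha> i) ^ m i * fps_blaschke_product \<alpha> (m(i := 0))"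
proof -
  interpret R: blaschke_sequence \<alpha> "m(i := 0)"
    by (rule remove_zero)
  let ?B = "fps_blaschke (\<alpha> i)"
  have B: "?B ^ m i \<in> h2"
    by (intro inner_fps_h2 inner_fps_power inner_fps_blaschke in_disc)
  have prod_h2: "?B ^ m i * R.\<Phi> \<in> h2"
    using inner_fps_power[OF inner_fps_blaschke[OF in_disc]] R.product_h2 by (auto simp: inner_fps_def)
  have "eval_fps \<Phi> z = eval_fps (?B ^ m i * R.\<Phi>) z" if z: "cmod z < 1" for z
  proof -
    let ?f = "\<lambda>j. if j \<in> {i} then blaschke_factor (\<alpha> i) z ^ m i else 1"
    have "?f has_prod (\<Prod>j\<in>{i}. blaschke_factor (\<alpha> i) z ^ m i)"
      by (rule has_prod_If_finite_set) simp
    moreover have "(\<lambda>j. blaschke_factor (\<alpha> j) z ^ (m(i := 0)) j) has_prod blaschke_product \<alpha> (m(i := 0)) z"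
      unfolding blaschke_product_def by (rule convergent_prod_has_prod[OF R.convergent[OF z]])
    ultimately have "(\<lambda>j. ?f j * blaschke_factor (\<alpha> j) z ^ (m(i := 0)) j) has_prod
        ((\<Prod>j\<in>{i}. blaschke_factor (\<alpha> i) z ^ m i) * blaschke_product \<alpha> (m(i := 0)) z)"
      by (rule has_prod_mult)
    moreover have "(\<lambda>j. ?f j * blaschke_factor (\<alpha> j) z ^ (m(i := 0)) j) = (\<lambda>j. blaschke_factor (\<alpha> j) z ^ m j)"
      by auto
    ultimately have "blaschke_product \<alpha> m z = blaschke_factor (\<alpha> i) z ^ m i * blaschke_product \<alpha> (m(i := 0)) z"
      unfolding blaschke_product_def using has_prod_unique by fastforce
    moreover have "eval_fps (?B ^ m i) z = blaschke_factor (\<alpha> i) z ^ m i"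
      using eval_fps_power[OF h2_in_conv_radius[OF h2_fps_blaschke[OF in_disc] z]] z
      by (simp add: eval_fps_blaschke in_disc)
    ultimately show ?thesis
      using z by (simp add: eval_fps_product R.eval_fps_product eval_fps_h2_mult[OF B R.product_h2])
  qed
  then have "eventually (\<lambda>z. eval_fps \<Phi> z = eval_fps (?B ^ m i * R.\<Phi>) z) (nhds 0)"
    using eventually_in_disc[of 0] by (auto elim: eventually_mono)
  then show ?thesis
    using h2_in_conv_radius[OF product_h2, of 0] h2_in_conv_radius[OF prod_h2, of 0]
    by (intro eval_fps_eqD) (auto simp: zero_ereal_def)
qed

lemma product_in_zero_space: "\<Phi> \<in> zero_space \<alpha> m"
proof -
  have "vanishes_to (m i) \<Phi> (\<alpha> i)" for i
  proof -
    interpret R: blaschke_sequence \<alpha> "m(i := 0)"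
      by (rule remove_zero)
    show ?thesis
      unfolding product_factorization[of i]
      by (rule vanishes_to_fps_blaschke_power[OF in_disc R.product_h2])
  qed
  then show ?thesis
    using product_h2 by (simp add: zero_space_def)
qed

text \<open>
  The origin may or may not occur among the zeros. In both cases its multiplicity \<open>k\<close> in the Blaschke
  product is the order of vanishing common to all of \<open>M\<close>, so that the later argument need not
  distinguish the cases.
\<close>

lemma split_zero_at_origin:
  obtains \<Psi> k where "\<Psi> \<in> h2" "\<Phi> = fps_X ^ k * \<Psi>" "fps_nth \<Psi> 0 \<noteq> 0" "\<forall>i. \<alpha> i = 0 \<longrightarrow> m i = k"
    "\<forall>H\<in>zero_space \<alpha> m. \<exists>Q\<in>h2. H = fps_X ^ k * Q"
proof (cases "\<exists>i. \<alpha> i = 0")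
  case True
  then obtain i where i: "\<alpha> i = 0"
    by blast
  interpret R: blaschke_sequence \<alpha> "m(i := 0)"
    by (rule remove_zero)
  have others: "\<alpha> j \<noteq> 0" if "j \<noteq> i" for j
    using that i inj by (metis injD)
  show ?thesis
  proof (rule that[of R.\<Phi> "m i"])
    show "\<Phi> = fps_X ^ m i * R.\<Phi>"
      using product_factorization[of i] by (simp add: i fps_blaschke_0)
    have "blaschke_product \<alpha> (m(i := 0)) 0 \<noteq> 0"
      using others by (intro R.nonzero) (auto split: if_splits)
    then show "fps_nth R.\<Phi> 0 \<noteq> 0"
      using R.eval_fps_product[of 0] by (simp add: eval_fps_at_0)
    show "\<forall>j. \<alpha> j = 0 \<longrightarrow> m j = m i"
      using others by metis
    show "\<forall>H\<in>zero_space \<alpha> m. \<exists>Q\<in>h2. H = fps_X ^ m i * Q"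
    proof
      fix H
      assume "H \<in> zero_space \<alpha> m"
      then have "H \<in> h2" "vanishes_to (m i) H 0"
        unfolding zero_space_def using i by (blast, metis (mono_tags, lifting) mem_Collect_eq)
      then show "\<exists>Q\<in>h2. H = fps_X ^ m i * Q"
        using divide_fps_blaschke_power[of 0 H "m i"] by (simp add: fps_blaschke_0)
    qed
  qed (rule R.product_h2)
next
  case False
  show ?thesis
  proof (rule that[of \<Phi> 0])
    have "blaschke_product \<alpha> m 0 \<noteq> 0"
      using False by (intro nonzero) auto
    then show "fps_nth \<Phi> 0 \<noteq> 0"
      using eval_fps_product[of 0] by (simp add: eval_fps_at_0)
  qed (use False product_h2 in \<open>auto simp: zero_space_def\<close>)
qed

text \<open>
  Divide \<open>H\<close> and \<open>\<Phi>\<close> by \<open>z^k\<close>, where \<open>k\<close> is the multiplicity of the zero at the origin, and choose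
  \<open>c\<close> such that the difference of the quotients vanishes at \<open>0\<close>. Then \<open>H - c\<Phi> = zG\<close>. At the zeros
  off the origin \<open>z\<close> is a unit, so \<open>G\<close> inherits the order of vanishing from \<open>H\<close> and \<open>\<Phi>\<close>.
\<close>

lemma zero_space_decomposition:
  assumes H: "H \<in> zero_space \<alpha> m"
  obtains c G where "G \<in> zero_space \<alpha> m" "H = fps_const c * \<Phi> + fps_X * G"
proof -
  obtain \<Psi> k where \<Psi>: "\<Psi> \<in> h2" "\<Phi> = fps_X ^ k * \<Psi>" "fps_nth \<Psi> 0 \<noteq> 0" "\<forall>i. \<alpha> i = 0 \<longrightarrow> m i = k"
    and div: "\<forall>H\<in>zero_space \<alpha> m. \<exists>Q\<in>h2. H = fps_X ^ k * Q"
    using split_zero_at_origin .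
  obtain Q where Q: "Q \<in> h2" "H = fps_X ^ k * Q"
    using div H by blast
  define c where "c = fps_nth Q 0 / fps_nth \<Psi> 0"
  have D: "Q - fps_const c * \<Psi> \<in> h2"
    using Q \<Psi> by auto
  have "eval_fps (Q - fps_const c * \<Psi>) 0 = 0"
    using \<Psi>(3) by (simp add: eval_fps_at_0 c_def)
  then obtain G' where G': "G' \<in> h2" "Q - fps_const c * \<Psi> = fps_X * G'"
    using h2_divide_fps_blaschke[of 0 "Q - fps_const c * \<Psi>"] D by (auto simp: fps_blaschke_0)
  define G where "G = fps_X ^ k * G'"
  have inner: "inner_fps (fps_X ^ k)"
    using inner_fps_power[OF inner_fps_blaschke[of 0]] by (simp add: fps_blaschke_0)
  have G: "G \<in> h2"
    using inner G'(1) by (simp add: G_def inner_fps_def)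
  have eq: "H - fps_const c * \<Phi> = fps_X * G"
  proof -
    have "H - fps_const c * \<Phi> = fps_X ^ k * (Q - fps_const c * \<Psi>)"
      by (simp add: Q(2) \<Psi>(2) right_diff_distrib mult_ac)
    then show ?thesis
      unfolding G'(2) G_def by (simp only: mult_ac)
  qed
  have "vanishes_to (m i) G (\<alpha> i)" for i
  proof (cases "\<alpha> i = 0")
    case True
    then show ?thesis
      using vanishes_to_fps_blaschke_power[of 0 G' k] G' \<Psi>(4) True by (simp add: G_def fps_blaschke_0)
  next
    case False
    have "vanishes_to (m i) (fps_X * G) (\<alpha> i)"
      unfolding eq[symmetric] using H product_in_zero_space product_h2 in_disc
      by (intro vanishes_to_diff vanishes_to_cmult h2_cmult) (auto simp: zero_space_def)
    then show ?thesis
      using vanishes_to_mult_iff[of fps_X G "\<alpha> i" "m i"] G False in_disc h2_X_mult_iff[of 1] by simp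
  qed
  then have "G \<in> zero_space \<alpha> m"
    using G by (simp add: zero_space_def)
  moreover have "H = fps_const c * \<Phi> + fps_X * G"
    using eq by (simp add: algebra_simps)
  ultimately show ?thesis
    using that by blast
qed

lemma product_nonzero: "\<Phi> \<noteq> 0"
proof -
  obtain \<Psi> k where "\<Psi> \<in> h2" "\<Phi> = fps_X ^ k * \<Psi>" "fps_nth \<Psi> 0 \<noteq> 0"
      "\<forall>i. \<alpha> i = 0 \<longrightarrow> m i = k" "\<forall>H\<in>zero_space \<alpha> m. \<exists>Q\<in>h2. H = fps_X ^ k * Q"
    by (rule split_zero_at_origin)
  then show ?thesis
    by auto
qed

text \<open>
  Decompose \<open>F = c\<Phi> + zG\<close>. Both \<open>F\<close> and \<open>\<Phi>\<close> are orthogonal to \<open>zG\<close>, hence \<open>zG\<close> is orthogonal to itself.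
\<close>

lemma orthogonal_imp_multiple:
  assumes F: "F \<in> zero_space \<alpha> m"
    and orth: "\<And>H. H \<in> zero_space \<alpha> m \<Longrightarrow> h2_inner F (fps_X * H) = 0"
  obtains c where "F = fps_const c * \<Phi>"
proof -
  obtain c G where G: "G \<in> zero_space \<alpha> m" "F = fps_const c * \<Phi> + fps_X * G"
    using zero_space_decomposition[OF F] .
  have XG: "fps_X * G \<in> h2" and Fh: "F \<in> h2"
    using G F by (auto simp: zero_space_def h2_X_mult_iff)
  have "fps_X * G = F - fps_const c * \<Phi>"
    using G by simp
  then have "h2_inner (fps_X * G) (fps_X * G) = h2_inner F (fps_X * G) - c * h2_inner \<Phi> (fps_X * G)"
    using XG Fh product_h2 by (metis h2_inner_diff_left h2_inner_cmult_left h2_cmult)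
  also have "\<dots> = 0"
    using orth product_orthogonal G(1) by simp
  finally have "fps_X * G = 0"
    using h2_inner_self_eq_0_iff[OF XG] by simp
  then show ?thesis
    using that[of c] G(2) by simp
qed

text \<open>
  In \<open>H = c\<Phi> + zG\<close> the summand \<open>zG\<close> is orthogonal to \<open>\<Phi>\<close> and vanishes at \<open>0\<close>; therefore \<open>c \<noteq> 0\<close>.
\<close>

lemma inner_product_nonzero:
  assumes H: "H \<in> zero_space \<alpha> m" and H0: "fps_nth H 0 \<noteq> 0"
  shows "h2_inner \<Phi> H \<noteq> 0"
proof -
  obtain c G where G: "G \<in> zero_space \<alpha> m" "H = fps_const c * \<Phi> + fps_X * G"
    using zero_space_decomposition[OF H] .
  have "c \<noteq> 0"
    using H0 G(2) by auto
  have "h2_inner \<Phi> H = cnj c * h2_inner \<Phi> \<Phi>"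
    using G product_h2 product_orthogonal[OF G(1)]
    by (simp add: h2_inner_add_right h2_inner_cmult_right h2_cmult h2_X_mult_iff zero_space_def)
  then show ?thesis
    using \<open>c \<noteq> 0\<close> product_nonzero h2_inner_self_eq_0_iff[OF product_h2] by simp
qed

end

section \<open>The Hardy space of the bidisc, row by row\<close>

text \<open>
  Membership in \<^const>\<open>hardy_bidisc\<close> refers to the Taylor coefficients, that is, to iterated derivatives.
  Here the coefficients are a parameter instead, so that functions can be given by series; that the
  parameter has to be the family of Taylor coefficients is shown afterwards.
\<close>

definition hardy_series :: "(nat \<times> nat \<Rightarrow> complex) \<Rightarrow> (complex \<times> complex \<Rightarrow> complex) \<Rightarrow> bool" where
  "hardy_series a F \<longleftrightarrow> (\<lambda>k. (cmod (a k))\<^sup>2) summable_on UNIV \<and>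
     (\<forall>p\<in>bidisc. ((\<lambda>k. a k * fst p ^ fst k * snd p ^ snd k) has_sum F p) UNIV) \<and>
     (\<forall>p. p \<notin> bidisc \<longrightarrow> F p = 0)"

definition row :: "(nat \<times> nat \<Rightarrow> complex) \<Rightarrow> nat \<Rightarrow> complex fps" where
  "row a i = Abs_fps (\<lambda>j. a (i, j))"

lemma fps_nth_row [simp]: "fps_nth (row a i) j = a (i, j)"
  by (simp add: row_def)

lemma bidisc_iff [simp]: "(z, w) \<in> bidisc \<longleftrightarrow> cmod z < 1 \<and> cmod w < 1"
  by (simp add: bidisc_def)

lemma hardy_series_square_summable:
    "hardy_series a F \<Longrightarrow> (\<lambda>k. (cmod (a k))\<^sup>2) summable_on UNIV"
  and hardy_series_has_sum:
    "hardy_series a F \<Longrightarrow> p \<in> bidisc \<Longrightarrow>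
      ((\<lambda>k. a k * fst p ^ fst k * snd p ^ snd k) has_sum F p) UNIV"
  and hardy_series_outside: "hardy_series a F \<Longrightarrow> p \<notin> bidisc \<Longrightarrow> F p = 0"
  unfolding hardy_series_def by blast+

lemma row_h2:
  assumes "hardy_series a F"
  shows "row a i \<in> h2"
proof -
  have "(\<lambda>k. (cmod (a k))\<^sup>2) summable_on range (Pair i)"
    by (rule summable_on_subset_banach[OF hardy_series_square_summable[OF assms]]) simp
  then have "((\<lambda>k. (cmod (a k))\<^sup>2) \<circ> Pair i) summable_on UNIV"
    using summable_on_reindex[of "Pair i" UNIV "\<lambda>k. (cmod (a k))\<^sup>2"] by (simp add: inj_on_def)
  then have "(\<lambda>j. (cmod (a (i, j)))\<^sup>2) summable_on UNIV"
    by (simp add: o_def)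
  then show ?thesis
    by (simp add: h2_def summable_on_imp_summable)
qed

lemma h2_has_sum_eval_fps:
  assumes "A \<in> h2" "cmod w < 1"
  shows "((\<lambda>j. fps_nth A j * w ^ j) has_sum eval_fps A w) UNIV"
proof (rule norm_summable_imp_has_sum)
  show "summable (\<lambda>j. norm (fps_nth A j * w ^ j))"
    by (intro norm_summable_fps h2_in_conv_radius assms)
  show "(\<lambda>j. fps_nth A j * w ^ j) sums eval_fps A w"
    unfolding eval_fps_def by (intro summable_sums summable_fps h2_in_conv_radius assms)
qed

lemma hardy_series_row_has_sum:
  assumes "hardy_series a F" "cmod w < 1"
  shows "((\<lambda>j. a (i, j) * z ^ i * w ^ j) has_sum z ^ i * eval_fps (row a i) w) UNIV"
  using has_sum_cmult_right[OF h2_has_sum_eval_fps[OF row_h2[OF assms(1), of i] assms(2)], of "z ^ i"]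
  by (simp add: mult_ac)

lemma hardy_series_rows_has_sum:
  assumes "hardy_series a F" "cmod z < 1" "cmod w < 1"
  shows "((\<lambda>i. z ^ i * eval_fps (row a i) w) has_sum F (z, w)) UNIV"
proof (rule has_sum_SigmaD)
  from hardy_series_has_sum[OF assms(1), of "(z, w)"]
  show "((\<lambda>k. a k * z ^ fst k * w ^ snd k) has_sum F (z, w)) (UNIV \<times> UNIV)"
    using assms by simp
qed (use hardy_series_row_has_sum[OF assms(1,3)] in auto)

lemma higher_deriv_sum_cmult:
  assumes "finite X" "\<And>i. i \<in> X \<Longrightarrow> f i analytic_on {w}"
  shows "(deriv ^^ j) (\<lambda>w. \<Sum>i\<in>X. c i * f i w) w = (\<Sum>i\<in>X. c i * (deriv ^^ j) (f i) w)"
  using assms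
proof (induction X rule: finite_induct)
  case (insert x X)
  have "(deriv ^^ j) (\<lambda>w. c x * f x w + (\<Sum>i\<in>X. c i * f i w)) w
      = (deriv ^^ j) (\<lambda>w. c x * f x w) w + (deriv ^^ j) (\<lambda>w. \<Sum>i\<in>X. c i * f i w) w"
    using insert.prems by (intro higher_deriv_add_at analytic_intros) auto
  then show ?case
    using insert by (simp add: higher_deriv_cmult')
qed simp

text \<open>
  For fixed \<open>z\<close> the rows form a series in \<open>w\<close> that converges uniformly on a disc of radius \<open>r < 1\<close>
  around \<open>0\<close> containing the given point, being dominated by the absolute sums of the rows at
  \<open>(z, r)\<close>. Such a series of holomorphic functions may be differentiated term by term.
\<close>

lemma hardy_series_deriv_has_sum:
  assumes F: "hardy_series a F" and z: "cmod z < 1" and w: "cmod w < 1"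
  shows "((\<lambda>i. z ^ i * (deriv ^^ j) (eval_fps (row a i)) w) has_sum (deriv ^^ j) (\<lambda>w. F (z, w)) w) UNIV"
proof -
  obtain r where r: "cmod w < r" "r < 1"
    using dense[OF w] by blast
  then have r0: "0 < r"
    using norm_ge_zero[of w] by linarith
  define M where "M = (\<lambda>i. \<Sum>\<^sub>\<infinity>j. cmod (a (i, j) * z ^ i * of_real r ^ j))"
  from hardy_series_has_sum[OF F, of "(z, of_real r)"]
  have "(\<lambda>k. a k * z ^ fst k * of_real r ^ snd k) summable_on UNIV"
    using z r r0 by (auto simp: summable_on_def)
  then have "(\<lambda>k. cmod (a k * z ^ fst k * of_real r ^ snd k)) summable_on (UNIV \<times> UNIV)"
    by (subst (asm) summable_on_iff_abs_summable_on_complex) simp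
  then have rows: "(\<lambda>j. cmod (a (i, j) * z ^ i * of_real r ^ j)) summable_on UNIV"
    and M: "(\<lambda>i. norm (M i)) summable_on UNIV" for i
    unfolding Infinite_Sum.abs_summable_on_Sigma_iff M_def by auto
  have le: "cmod (z ^ i * eval_fps (row a i) u) \<le> M i" if "u \<in> ball 0 r" for i u
  proof (rule norm_infsum_le)
    show "((\<lambda>j. a (i, j) * z ^ i * u ^ j) has_sum z ^ i * eval_fps (row a i) u) UNIV"
      using that r by (intro hardy_series_row_has_sum[OF F]) auto
    show "((\<lambda>j. cmod (a (i, j) * z ^ i * of_real r ^ j)) has_sum M i) UNIV"
      unfolding M_def using rows[of i] by (rule has_sum_infsum)
    show "cmod (a (i, j) * z ^ i * u ^ j) \<le> cmod (a (i, j) * z ^ i * of_real r ^ j)" for j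
      using that r0 by (auto simp: norm_mult norm_power intro!: mult_left_mono power_mono)
  qed
  have "uniform_limit (ball 0 r) (\<lambda>X u. \<Sum>i\<in>X. z ^ i * eval_fps (row a i) u) (\<lambda>u. F (z, u))
      (finite_subsets_at_top UNIV)"
  proof (rule Weierstrass_m_test_general')
    show "((\<lambda>i. z ^ i * eval_fps (row a i) u) has_sum F (z, u)) UNIV" if "u \<in> ball 0 r" for u
      using that r by (intro hardy_series_rows_has_sum[OF F z]) auto
    show "M summable_on UNIV"
      using M by (rule Infinite_Sum.abs_summable_summable)
  qed (use le in auto)
  moreover have "\<forall>\<^sub>F X in finite_subsets_at_top UNIV.
      (\<lambda>u. \<Sum>i\<in>X. z ^ i * eval_fps (row a i) u) holomorphic_on ball 0 r"
  proof (intro always_eventually allI holomorphic_intros)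
    fix i
    show "ball 0 r \<subseteq> eball 0 (fps_conv_radius (row a i))"
      using h2_disc_subset_eball[OF row_h2[OF F]] r(2) by fastforce
  qed
  ultimately have "((\<lambda>X. (deriv ^^ j) (\<lambda>u. \<Sum>i\<in>X. z ^ i * eval_fps (row a i) u) w)
      \<longlongrightarrow> (deriv ^^ j) (\<lambda>u. F (z, u)) w) (finite_subsets_at_top UNIV)"
    using r by (intro higher_deriv_complex_uniform_limit) auto
  moreover have "\<forall>\<^sub>F X in finite_subsets_at_top UNIV.
      (deriv ^^ j) (\<lambda>u. \<Sum>i\<in>X. z ^ i * eval_fps (row a i) u) w
      = (\<Sum>i\<in>X. z ^ i * (deriv ^^ j) (eval_fps (row a i)) w)"
    by (rule eventually_mono[OF eventually_finite_subsets_at_top_weakI[where P = finite]])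
       (auto intro!: higher_deriv_sum_cmult eval_fps_h2_analytic row_h2[OF F] w)
  ultimately show ?thesis
    unfolding has_sum_def by (rule Lim_transform_eventually)
qed

text \<open>
  The derivative in the second variable is a power series in the first variable whose coefficients
  are the derivatives of the rows; differentiating at \<open>z\<^sub>1 = 0\<close> picks out one of them. This is what
  decouples the rows.
\<close>

lemma mixed_deriv_hardy_series:
  assumes F: "hardy_series a F" and w: "cmod w < 1"
  shows "mixed_deriv i j F (0, w) = fact i * (deriv ^^ j) (eval_fps (row a i)) w"
proof -
  define C where "C = Abs_fps (\<lambda>i. (deriv ^^ j) (eval_fps (row a i)) w)"
  have "(\<lambda>z. (deriv ^^ j) (\<lambda>w. F (z, w)) w) has_fps_expansion C"
  proof (rule has_fps_expansionI)
    have "(\<lambda>n. fps_nth C n * z ^ n) sums (deriv ^^ j) (\<lambda>w. F (z, w)) w" if "cmod z < 1" for z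
      using has_sum_imp_sums[OF hardy_series_deriv_has_sum[OF F that w, of j]]
      by (simp add: C_def mult.commute)
    then show "\<forall>\<^sub>F z in nhds 0. (\<lambda>n. fps_nth C n * z ^ n) sums (deriv ^^ j) (\<lambda>w. F (z, w)) w"
      using eventually_in_disc[of 0] by (auto elim: eventually_mono)
  qed
  from fps_nth_fps_expansion[OF this, of i] show ?thesis
    by (simp add: mixed_deriv_def C_def)
qed

lemma taylor_coeff_hardy_series:
  assumes F: "hardy_series a F"
  shows "taylor_coeff F = a"
proof
  fix k :: "nat \<times> nat"
  obtain i j where k: "k = (i, j)"
    by fastforce
  have "fps_nth (fps_recenter 0 (row a i)) j = a (i, j)"
    using fps_recenter_0[OF row_h2[OF F]] by simp
  then show "taylor_coeff F k = a k"
    using mixed_deriv_hardy_series[OF F, of 0 i j]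
    by (simp add: taylor_coeff_def k fps_nth_recenter)
qed

lemma hardy_bidisc_iff: "F \<in> hardy_bidisc \<longleftrightarrow> hardy_series (taylor_coeff F) F"
  by (simp add: hardy_bidisc_def hardy_series_def)

lemma hardy_series_in_hardy_bidisc: "hardy_series a F \<Longrightarrow> F \<in> hardy_bidisc"
  using taylor_coeff_hardy_series[of a F] by (simp add: hardy_bidisc_iff)

lemma hardy_series_unique:
  assumes "hardy_series a F" "hardy_series a G"
  shows "F = G"
proof
  fix p show "F p = G p"
  proof (cases "p \<in> bidisc")
    case True
    then show ?thesis
      using hardy_series_has_sum assms has_sum_unique by blast
  qed (simp add: hardy_series_outside[OF assms(1)] hardy_series_outside[OF assms(2)])
qed

lemma hardy_series_add:
  assumes F: "hardy_series a F" and G: "hardy_series b G"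
  shows "hardy_series (\<lambda>k. a k + b k) (\<lambda>p. F p + G p)"
  unfolding hardy_series_def
proof (intro conjI ballI allI impI)
  have "(\<lambda>k. 2 * (cmod (a k))\<^sup>2 + 2 * (cmod (b k))\<^sup>2) summable_on UNIV"
    by (intro summable_on_add summable_on_cmult_right hardy_series_square_summable[OF F]
        hardy_series_square_summable[OF G])
  then show "(\<lambda>k. (cmod (a k + b k))\<^sup>2) summable_on UNIV"
  proof (rule summable_on_comparison_test)
    fix k
    have "(cmod (a k + b k))\<^sup>2 \<le> (cmod (a k) + cmod (b k))\<^sup>2"
      by (intro power_mono norm_triangle_ineq) simp
    also have "\<dots> \<le> 2 * (cmod (a k))\<^sup>2 + 2 * (cmod (b k))\<^sup>2"
      using sum_squares_bound[of "cmod (a k)" "cmod (b k)"] by (simp add: power2_sum)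
    finally show "(cmod (a k + b k))\<^sup>2 \<le> 2 * (cmod (a k))\<^sup>2 + 2 * (cmod (b k))\<^sup>2" .
  qed simp
  fix p :: "complex \<times> complex"
  show "((\<lambda>k. (a k + b k) * fst p ^ fst k * snd p ^ snd k) has_sum F p + G p) UNIV" if "p \<in> bidisc"
    unfolding distrib_right
    by (intro has_sum_add hardy_series_has_sum[OF F that] hardy_series_has_sum[OF G that])
  show "F p + G p = 0" if "p \<notin> bidisc"
    by (simp add: hardy_series_outside[OF F that] hardy_series_outside[OF G that])
qed

definition shift1 :: "(nat \<times> nat \<Rightarrow> complex) \<Rightarrow> nat \<times> nat \<Rightarrow> complex" where
  "shift1 a k = (if fst k = 0 then 0 else a (fst k - 1, snd k))"

definition shift2 :: "(nat \<times> nat \<Rightarrow> complex) \<Rightarrow> nat \<times> nat \<Rightarrow> complex" where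
  "shift2 a k = (if snd k = 0 then 0 else a (fst k, snd k - 1))"

text \<open>
  Multiplication by a monomial \<open>u\<close> moves the terms of the series along the injection \<open>s\<close>.
\<close>

lemma hardy_series_reindex:
  assumes F: "hardy_series a F" and inj: "inj s"
    and on: "\<And>k. b (s k) = a k" and off: "\<And>k. k \<notin> range s \<Longrightarrow> b k = 0"
    and mult: "\<And>p k. fst p ^ fst (s k) * snd p ^ snd (s k) = u p * (fst p ^ fst k * snd p ^ snd k)"
  shows "hardy_series b (\<lambda>p. u p * F p)"
  unfolding hardy_series_def
proof (intro conjI ballI allI impI)
  have "(\<lambda>k. (cmod (b k))\<^sup>2) summable_on range s"
    using hardy_series_square_summable[OF F] by (subst summable_on_reindex[OF inj]) (simp add: o_def on)
  then show "(\<lambda>k. (cmod (b k))\<^sup>2) summable_on UNIV"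
    by (rule summable_on_cong_neutral[THEN iffD1, rotated -1]) (auto simp: off)
  fix p :: "complex \<times> complex"
  assume p: "p \<in> bidisc"
  have "((\<lambda>k. u p * (a k * fst p ^ fst k * snd p ^ snd k)) has_sum u p * F p) UNIV"
    by (intro has_sum_cmult_right hardy_series_has_sum[OF F p])
  also have "(\<lambda>k. u p * (a k * fst p ^ fst k * snd p ^ snd k))
      = (\<lambda>k. b k * fst p ^ fst k * snd p ^ snd k) \<circ> s"
    by (simp add: fun_eq_iff on mult mult.assoc)
  finally have "((\<lambda>k. b k * fst p ^ fst k * snd p ^ snd k) has_sum u p * F p) (range s)"
    by (subst has_sum_reindex[OF inj])
  then show "((\<lambda>k. b k * fst p ^ fst k * snd p ^ snd k) has_sum u p * F p) UNIV"
    by (rule has_sum_cong_neutral[THEN iffD1, rotated -1]) (auto simp: off)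
qed (simp add: hardy_series_outside[OF F])

lemma hardy_series_shift1:
  assumes "hardy_series a F"
  shows "hardy_series (shift1 a) (\<lambda>p. fst p * F p)"
proof (rule hardy_series_reindex[OF assms])
  let ?s = "\<lambda>k :: nat \<times> nat. (Suc (fst k), snd k)"
  show "inj ?s"
    by (auto simp: inj_on_def prod_eq_iff)
  show "shift1 a k = 0" if "k \<notin> range ?s" for k
  proof (cases "fst k")
    case (Suc i)
    then have "k = ?s (i, snd k)"
      by (simp add: prod_eq_iff)
    then show ?thesis
      using that by blast
  qed (simp add: shift1_def)
qed (simp_all add: shift1_def)

lemma hardy_series_shift2:
  assumes "hardy_series a F"
  shows "hardy_series (shift2 a) (\<lambda>p. snd p * F p)"
proof (rule hardy_series_reindex[OF assms])
  let ?s = "\<lambda>k :: nat \<times> nat. (fst k, Suc (snd k))"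
  show "inj ?s"
    by (auto simp: inj_on_def prod_eq_iff)
  show "shift2 a k = 0" if "k \<notin> range ?s" for k
  proof (cases "snd k")
    case (Suc j)
    then have "k = ?s (fst k, j)"
      by (simp add: prod_eq_iff)
    then show ?thesis
      using that by blast
  qed (simp add: shift2_def)
qed (simp_all add: shift2_def)

lemma row_add: "row (\<lambda>k. a k + b k) i = row a i + row b i"
  by (rule fps_ext) simp

lemma row_shift1: "row (shift1 a) i = (if i = 0 then 0 else row a (i - 1))"
  by (rule fps_ext) (simp add: shift1_def)

lemma row_shift2: "row (shift2 a) i = fps_X * row a i"
  by (rule fps_ext) (simp add: shift2_def)

definition row_coeffs :: "nat \<Rightarrow> complex fps \<Rightarrow> nat \<times> nat \<Rightarrow> complex" where
  "row_coeffs i A k = (if fst k = i then fps_nth A (snd k) else 0)"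

definition row_fun :: "nat \<Rightarrow> complex fps \<Rightarrow> complex \<times> complex \<Rightarrow> complex" where
  "row_fun i A p = (if p \<in> bidisc then fst p ^ i * eval_fps A (snd p) else 0)"

lemma row_row_coeffs: "row (row_coeffs i A) i' = (if i' = i then A else 0)"
  by (rule fps_ext) (simp add: row_coeffs_def)

lemma has_sum_row:
  fixes g :: "nat \<times> nat \<Rightarrow> 'a :: {topological_comm_monoid_add, t2_space}"
  assumes "\<And>k. fst k \<noteq> i \<Longrightarrow> g k = 0"
  shows "(g has_sum s) UNIV \<longleftrightarrow> ((\<lambda>j. g (i, j)) has_sum s) UNIV"
proof -
  have "(g has_sum s) UNIV \<longleftrightarrow> (g has_sum s) (range (Pair i :: nat \<Rightarrow> nat \<times> nat))"
  proof (rule has_sum_cong_neutral)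
    fix k :: "nat \<times> nat"
    assume "k \<in> UNIV - range (Pair i)"
    then have "fst k \<noteq> i"
      by (metis DiffE prod.collapse rangeI)
    then show "g k = 0"
      by (rule assms)
  qed auto
  also have "\<dots> \<longleftrightarrow> ((\<lambda>j. g (i, j)) has_sum s) UNIV"
    by (subst has_sum_reindex) (auto simp: inj_on_def o_def)
  finally show ?thesis .
qed

lemma hardy_series_row_fun:
  assumes A: "A \<in> h2"
  shows "hardy_series (row_coeffs i A) (row_fun i A)"
  unfolding hardy_series_def
proof (intro conjI ballI allI impI)
  have "(\<lambda>j. (cmod (fps_nth A j))\<^sup>2) summable_on UNIV"
    using A by (intro summable_nonneg_imp_summable_on) (auto simp: h2_def)
  then obtain s where "((\<lambda>j. (cmod (fps_nth A j))\<^sup>2) has_sum s) UNIV"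
    by (auto simp: summable_on_def)
  then have "((\<lambda>k. (cmod (row_coeffs i A k))\<^sup>2) has_sum s) UNIV"
    by (subst has_sum_row[of i]) (simp_all add: row_coeffs_def)
  then show "(\<lambda>k. (cmod (row_coeffs i A k))\<^sup>2) summable_on UNIV"
    by (auto simp: summable_on_def)
  fix p :: "complex \<times> complex"
  assume p: "p \<in> bidisc"
  then have "cmod (snd p) < 1"
    by (simp add: bidisc_def mem_Times_iff)
  from has_sum_cmult_right[OF h2_has_sum_eval_fps[OF A this], of "fst p ^ i"]
  show "((\<lambda>k. row_coeffs i A k * fst p ^ fst k * snd p ^ snd k) has_sum row_fun i A p) UNIV"
    using p by (subst has_sum_row[of i]) (simp_all add: row_coeffs_def row_fun_def mult_ac)
qed (simp add: row_fun_def)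

lemma h2_inner_has_sum:
  assumes "A \<in> h2" "B \<in> h2"
  shows "((\<lambda>j. fps_nth A j * cnj (fps_nth B j)) has_sum h2_inner A B) UNIV"
  unfolding h2_inner_def
  by (intro norm_summable_imp_has_sum h2_inner_abs_summable summable_sums h2_inner_summable assms)

lemma row_fun_inner_has_sum:
  assumes "A \<in> h2" "hardy_series b G"
  shows "((\<lambda>k. row_coeffs i A k * cnj (b k)) has_sum h2_inner A (row b i)) UNIV"
  using h2_inner_has_sum[OF assms(1) row_h2[OF assms(2)], of i]
  by (subst has_sum_row[of i]) (simp_all add: row_coeffs_def)

lemma hardy_inner_row_fun_right:
  assumes "hardy_series a F" "B \<in> h2"
  shows "hardy_inner F (row_fun i B) = h2_inner (row a i) B"
  unfolding hardy_inner_def taylor_coeff_hardy_series[OF assms(1)]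
    taylor_coeff_hardy_series[OF hardy_series_row_fun[OF assms(2)]]
  using h2_inner_has_sum[OF row_h2[OF assms(1)] assms(2), of i]
  by (intro infsumI, subst has_sum_row[of i]) (simp_all add: row_coeffs_def)

lemma fst_mult_row_fun: "fst p * row_fun i A p = row_fun (Suc i) A p"
  by (simp add: row_fun_def)

lemma snd_mult_row_fun:
  assumes "A \<in> h2"
  shows "snd p * row_fun i A p = row_fun i (fps_X * A) p"
proof (cases "p \<in> bidisc")
  case True
  then have "cmod (snd p) < 1"
    by (simp add: bidisc_def mem_Times_iff)
  then have "eval_fps (fps_X * A) (snd p) = snd p * eval_fps A (snd p)"
    using eval_fps_h2_mult[of fps_X A] h2_X_mult_iff[of 1] assms by simp
  then show ?thesis
    by (simp add: row_fun_def)
qed (simp add: row_fun_def)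

lemma row_fun_0 [simp]: "row_fun i 0 p = 0"
  by (simp add: row_fun_def)

section \<open>The Rudin submodule\<close>

text \<open>
  The zeros of row \<open>k\<close>: the point \<open>\<alpha>\<^sub>n\<close> with \<open>n > k\<close> has index \<open>i = n - k - 1\<close> and multiplicity
  \<open>n - k = Suc i\<close>.
\<close>

definition rudin_zero :: "nat \<Rightarrow> nat \<Rightarrow> complex" where
  "rudin_zero k i = rudin_pt (i + k + 1)"

lemma rudin_pt_eq: "rudin_pt n = of_real (1 - 1 / real n ^ 3)"
  by (simp add: rudin_pt_def)

lemma cmod_rudin_pt:
  assumes "n \<ge> 1"
  shows "cmod (rudin_pt n) = 1 - 1 / real n ^ 3"
proof -
  have "1 / real n ^ 3 \<le> 1"
    using assms by simp
  then show ?thesis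
    unfolding rudin_pt_eq norm_of_real by simp
qed

lemma rudin_pt_inj:
  assumes "rudin_pt m = rudin_pt n" "m \<ge> 1" "n \<ge> 1"
  shows "m = n"
proof -
  have "real m ^ 3 = real n ^ 3"
    using assms(1) unfolding rudin_pt_eq of_real_eq_iff by simp
  then show ?thesis
    by (simp add: power_eq_iff_eq_base)
qed

lemma rudin_pt_eq_0_iff: "n \<ge> 1 \<Longrightarrow> rudin_pt n = 0 \<longleftrightarrow> n = 1"
  using rudin_pt_inj[of n 1] by (auto simp: rudin_pt_def)

text \<open>
  Row \<open>k\<close> satisfies the convergence condition because a zero of multiplicity \<open>i + 1\<close> has defect
  \<open>1 - |\<alpha>\<^sub>n| = n\<^sup>-\<^sup>3 \<le> (i + 1)\<^sup>-\<^sup>3\<close>, which leaves the summable bound \<open>(i + 1)\<^sup>-\<^sup>2\<close>.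
\<close>

interpretation rudin: blaschke_sequence "rudin_zero k" Suc for k
proof
  show "cmod (rudin_zero k i) < 1" for i
    by (simp add: rudin_zero_def cmod_rudin_pt)
  show "inj (rudin_zero k)"
    using rudin_pt_inj by (fastforce simp: inj_on_def rudin_zero_def)
  have "summable (\<lambda>i. inverse (real (Suc i) ^ 2))"
    using inverse_power_summable[of 2, where 'a = real] by (subst summable_Suc_iff) simp
  then show "summable (\<lambda>i. real (Suc i) * (1 - cmod (rudin_zero k i)))"
  proof (rule summable_comparison_test')
    fix i :: nat
    have "real (Suc i) * (1 / real (i + k + 1) ^ 3) \<le> real (Suc i) * (1 / real (Suc i) ^ 3)"
      by (intro mult_left_mono divide_left_mono power_mono) auto
    also have "\<dots> = inverse (real (Suc i) ^ 2)"
      by (simp add: field_simps power2_eq_square power3_eq_cube del: of_nat_Suc)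
    finally show "norm (real (Suc i) * (1 - cmod (rudin_zero k i))) \<le> inverse (real (Suc i) ^ 2)"
      by (simp add: rudin_zero_def cmod_rudin_pt)
  qed
qed

abbreviation rudin_space :: "nat \<Rightarrow> complex fps set" where
  "rudin_space k \<equiv> zero_space (rudin_zero k) Suc"

abbreviation rudin_phi :: "nat \<Rightarrow> complex fps" where
  "rudin_phi k \<equiv> fps_blaschke_product (rudin_zero k) Suc"

text \<open>
  The condition \<open>k + j < n\<close> on the mixed derivatives at \<open>(0, \<alpha>\<^sub>n)\<close> says that row \<open>k\<close> vanishes there
  to order \<open>n - k\<close>; reindexing by \<open>n = i + k + 1\<close> gives the spaces of the individual rows.
\<close>

lemma rudin_submodule_iff:
  assumes F: "hardy_series a F"
  shows "F \<in> rudin_submodule \<longleftrightarrow> (\<forall>k. row a k \<in> rudin_space k)"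
proof -
  have "zero_of_order_at_least n F (0, rudin_pt n) \<longleftrightarrow>
      (\<forall>k j. k + j < n \<longrightarrow> (deriv ^^ j) (eval_fps (row a k)) (rudin_pt n) = 0)" if "n \<ge> 1" for n
    using that by (simp add: zero_of_order_at_least_def mixed_deriv_hardy_series[OF F] cmod_rudin_pt)
  then have "F \<in> rudin_submodule \<longleftrightarrow>
      (\<forall>n\<ge>1. \<forall>k j. k + j < n \<longrightarrow> (deriv ^^ j) (eval_fps (row a k)) (rudin_pt n) = 0)"
    using hardy_series_in_hardy_bidisc[OF F] by (simp add: rudin_submodule_def)
  also have "\<dots> \<longleftrightarrow> (\<forall>k i j. j < Suc i \<longrightarrow> (deriv ^^ j) (eval_fps (row a k)) (rudin_pt (i + k + 1)) = 0)"
  proof (intro iffI allI impI)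
    fix n k j :: nat
    assume *: "\<forall>k i j. j < Suc i \<longrightarrow> (deriv ^^ j) (eval_fps (row a k)) (rudin_pt (i + k + 1)) = 0"
      and "k + j < n"
    then have "j < Suc (n - k - 1)" "n - k - 1 + k + 1 = n"
      by auto
    then show "(deriv ^^ j) (eval_fps (row a k)) (rudin_pt n) = 0"
      using * by metis
  qed auto
  also have "\<dots> \<longleftrightarrow> (\<forall>k. row a k \<in> rudin_space k)"
    using row_h2[OF F] by (simp add: zero_space_def vanishes_to_iff_deriv rudin_zero_def)
  finally show ?thesis .
qed

lemma rudin_submodule_hardy_series: "F \<in> rudin_submodule \<Longrightarrow> hardy_series (taylor_coeff F) F"
  by (simp add: rudin_submodule_def hardy_bidisc_iff)

lemma zero_in_zero_space: "0 \<in> rudin_space k"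
proof -
  have "eval_fps 0 = (\<lambda>_::complex. 0 :: complex)"
    by (rule ext) simp
  then show ?thesis
    by (simp add: zero_space_def vanishes_to_iff_deriv)
qed

lemma row_fun_in_rudin_submodule_iff:
  assumes "A \<in> h2"
  shows "row_fun k A \<in> rudin_submodule \<longleftrightarrow> A \<in> rudin_space k"
  unfolding rudin_submodule_iff[OF hardy_series_row_fun[OF assms]] row_row_coeffs
  using zero_in_zero_space by auto

lemma rudin_gen0_eq: "rudin_gen0 = row_fun 0 (rudin_phi 0)"
proof
  fix p :: "complex \<times> complex"
  show "rudin_gen0 p = row_fun 0 (rudin_phi 0) p"
    using rudin.eval_fps_product[of "snd p" 0]
    by (cases p) (simp add: rudin_gen0_def row_fun_def blaschke_product_def rudin_zero_def)
qed

lemma rudin_gen1_eq: "rudin_gen1 = row_fun 1 (rudin_phi 1)"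
proof
  fix p :: "complex \<times> complex"
  show "rudin_gen1 p = row_fun 1 (rudin_phi 1) p"
    using rudin.eval_fps_product[of "snd p" 1]
    by (cases p) (simp add: rudin_gen1_def row_fun_def blaschke_product_def rudin_zero_def)
qed

lemma scale_row_fun:
  assumes "A \<in> h2"
  shows "fun_scale c (row_fun i A) = row_fun i (fps_const c * A)"
proof
  fix p :: "complex \<times> complex"
  show "fun_scale c (row_fun i A) p = row_fun i (fps_const c * A) p"
    using eval_fps_h2_mult[of "fps_const c" A "snd p"] h2_cmult[of 1 c] assms
    by (cases p) (auto simp: fun_scale_def row_fun_def)
qed

text \<open>
  Here \<open>\<alpha>\<^sub>1 = 0\<close> enters: every function in \<open>M\<^sub>0\<close> vanishes at the origin, and after division by \<open>z\<close>
  its zeros at \<open>\<alpha>\<^sub>2, \<alpha>\<^sub>3, \<dots>\<close> remain, of even higher order than \<open>M\<^sub>1\<close> demands.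
\<close>

lemma rudin_space_0_divide:
  assumes "A \<in> rudin_space 0"
  obtains B where "B \<in> rudin_space 1" "A = fps_X * B"
proof -
  have A: "A \<in> h2" and van: "vanishes_to (Suc i) A (rudin_zero 0 i)" for i
    using assms by (simp_all add: zero_space_def)
  have "rudin_zero 0 0 = 0"
    by (simp add: rudin_zero_def rudin_pt_def)
  then have "eval_fps A 0 = 0"
    using van[of 0] by (simp add: vanishes_to_iff_deriv)
  then obtain B where B: "B \<in> h2" "A = fps_X * B"
    using h2_divide_fps_blaschke[of 0 A] A by (auto simp: fps_blaschke_0)
  have "vanishes_to (Suc i) B (rudin_zero 1 i)" for i
  proof -
    have "rudin_zero 0 (Suc i) \<noteq> 0"
      by (simp add: rudin_zero_def rudin_pt_eq_0_iff)
    then have "vanishes_to (Suc (Suc i)) B (rudin_zero 0 (Suc i))"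
      using van[of "Suc i"] vanishes_to_mult_iff[of fps_X B "rudin_zero 0 (Suc i)"] B
        h2_X_mult_iff[of 1] rudin.in_disc[of 0 "Suc i"] by simp
    then show ?thesis
      by (simp add: rudin_zero_def vanishes_to_mono[of "Suc (Suc i)"])
  qed
  then show ?thesis
    using that[of B] B by (simp add: zero_space_def)
qed

lemma rudin_space_mono:
  assumes "A \<in> rudin_space k"
  shows "A \<in> rudin_space (Suc k)"
proof -
  have "vanishes_to (Suc i) A (rudin_zero (Suc k) i)" for i
  proof -
    have "vanishes_to (Suc (Suc i)) A (rudin_zero k (Suc i))"
      using assms unfolding zero_space_def by blast
    then show ?thesis
      by (simp add: rudin_zero_def vanishes_to_mono[of "Suc (Suc i)"])
  qed
  then show ?thesis
    using assms by (simp add: zero_space_def)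
qed

text \<open>
  The computation row by row that is described at the beginning. The test functions are single rows
  \<open>z\<^sub>1^k A(z\<^sub>2)\<close> with \<open>A \<in> M\<^sub>k\<close>, for which the inner product on the bidisc reduces to that on the disc.
\<close>

lemma wandering_rudin_submodule_iff:
  "F \<in> wandering rudin_submodule \<longleftrightarrow>
    (\<exists>c d. F = fun_scale c rudin_gen0 + fun_scale d rudin_gen1)"
proof
  assume F: "F \<in> wandering rudin_submodule"
  let ?a = "taylor_coeff F"
  have FS: "F \<in> rudin_submodule"
    using F by (simp add: wandering_def)
  have orth: "hardy_inner F (\<lambda>p. fst p * G p + snd p * H p) = 0"
    if "G \<in> rudin_submodule" "H \<in> rudin_submodule" for G H
    using F that by (simp add: wandering_def)
  have Fa: "hardy_series ?a F"
    by (rule rudin_submodule_hardy_series[OF FS])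
  have rows: "row ?a k \<in> rudin_space k" for k
    using FS by (simp add: rudin_submodule_iff[OF Fa])
  have zero: "row_fun 0 0 \<in> rudin_submodule"
    by (simp add: row_fun_in_rudin_submodule_iff zero_in_zero_space)
  have orth2: "h2_inner (row ?a k) (fps_X * A) = 0" if A: "A \<in> rudin_space k" for k A
  proof -
    have "A \<in> h2"
      using A by (rule zero_space_h2)
    then have "row_fun k A \<in> rudin_submodule"
      using A by (simp add: row_fun_in_rudin_submodule_iff)
    from orth[OF zero this] show ?thesis
      using \<open>A \<in> h2\<close> hardy_inner_row_fun_right[OF Fa, of "fps_X * A" k]
      by (simp add: snd_mult_row_fun h2_X_mult_iff)
  qed
  have orth1: "h2_inner (row ?a (Suc k)) A = 0" if A: "A \<in> rudin_space k" for k A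
  proof -
    have "A \<in> h2"
      using A by (rule zero_space_h2)
    then have "row_fun k A \<in> rudin_submodule"
      using A by (simp add: row_fun_in_rudin_submodule_iff)
    from orth[OF this zero] show ?thesis
      using \<open>A \<in> h2\<close> hardy_inner_row_fun_right[OF Fa, of A "Suc k"]
      by (simp add: fst_mult_row_fun)
  qed
  have "\<exists>c. row ?a k = fps_const c * rudin_phi k" for k
    using rudin.orthogonal_imp_multiple[OF rows orth2] by metis
  then obtain c where c: "row ?a k = fps_const (c k) * rudin_phi k" for k
    by metis
  \<comment> \<open>The only zero at the origin is \<open>\<alpha>\<^sub>1\<close>, which is absent from all rows but the first. So
    \<open>\<phi>\<^sub>k\<close> does not vanish there for \<open>k \<ge> 1\<close>, and it is an obstruction to \<open>\<phi>\<^sub>k\<^sub>+\<^sub>1 \<bottom> M\<^sub>k\<close>.\<close>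
  have higher: "c (Suc k) = 0" if "k \<ge> 1" for k
  proof -
    have "blaschke_product (rudin_zero k) Suc 0 \<noteq> 0"
    proof (rule rudin.nonzero)
      show "rudin_zero k i \<noteq> 0" for i
        using that by (simp add: rudin_zero_def rudin_pt_eq_0_iff)
    qed simp
    then have "fps_nth (rudin_phi k) 0 \<noteq> 0"
      using rudin.eval_fps_product[of 0 k] by (simp add: eval_fps_at_0)
    moreover have "rudin_phi k \<in> rudin_space (Suc k)"
      by (rule rudin_space_mono[OF rudin.product_in_zero_space])
    ultimately have "h2_inner (rudin_phi (Suc k)) (rudin_phi k) \<noteq> 0"
      by (intro rudin.inner_product_nonzero)
    moreover have "c (Suc k) * h2_inner (rudin_phi (Suc k)) (rudin_phi k) = 0"
      using orth1[OF rudin.product_in_zero_space[of k]]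
      by (simp add: c h2_inner_cmult_left rudin.product_h2)
    ultimately show ?thesis
      by simp
  qed
  let ?G = "\<lambda>p. row_fun 0 (fps_const (c 0) * rudin_phi 0) p + row_fun 1 (fps_const (c 1) * rudin_phi 1) p"
  let ?b = "\<lambda>k. row_coeffs 0 (fps_const (c 0) * rudin_phi 0) k + row_coeffs 1 (fps_const (c 1) * rudin_phi 1) k"
  have G: "hardy_series ?b ?G"
    by (intro hardy_series_add hardy_series_row_fun h2_cmult rudin.product_h2)
  have "row ?a k = row ?b k" for k
  proof -
    have "k = 0 \<or> k = 1 \<or> (\<exists>l\<ge>1. k = Suc l)"
      by (cases k) (auto simp: Suc_le_eq)
    then show ?thesis
      by (auto simp: c row_add row_row_coeffs higher)
  qed
  then have "?a (k, j) = ?b (k, j)" for k j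
    by (metis fps_nth_row)
  then have "?a = ?b"
    by (intro ext) auto
  then have "F = ?G"
    using hardy_series_unique Fa G by metis
  then have "F = fun_scale (c 0) rudin_gen0 + fun_scale (c 1) rudin_gen1"
    by (simp add: rudin_gen0_eq rudin_gen1_eq scale_row_fun rudin.product_h2 fun_eq_iff)
  then show "\<exists>c d. F = fun_scale c rudin_gen0 + fun_scale d rudin_gen1"
    by blast
next
  assume "\<exists>c d. F = fun_scale c rudin_gen0 + fun_scale d rudin_gen1"
  then obtain c d where "F = fun_scale c rudin_gen0 + fun_scale d rudin_gen1"
    by blast
  define A where "A = fps_const c * rudin_phi 0"
  define B where "B = fps_const d * rudin_phi 1"
  have A: "A \<in> h2" and B: "B \<in> h2"
    unfolding A_def B_def by (intro h2_cmult rudin.product_h2)+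
  have F: "F = (\<lambda>p. row_fun 0 A p + row_fun 1 B p)"
    using \<open>F = _\<close> by (simp add: A_def B_def rudin_gen0_eq rudin_gen1_eq scale_row_fun rudin.product_h2 fun_eq_iff)
  let ?b = "\<lambda>k. row_coeffs 0 A k + row_coeffs 1 B k"
  have Fb: "hardy_series ?b F"
    unfolding F by (intro hardy_series_add hardy_series_row_fun A B)
  have cmult: "fps_const e * rudin_phi k \<in> rudin_space k" for e k
    using rudin.product_in_zero_space[of k] rudin.in_disc
    by (auto simp: zero_space_def intro: vanishes_to_cmult)
  have "F \<in> rudin_submodule"
    unfolding rudin_submodule_iff[OF Fb] row_add row_row_coeffs
    using cmult[of c 0] cmult[of d 1] zero_in_zero_space by (auto simp: A_def B_def)
  moreover have "hardy_inner F (\<lambda>p. fst p * G p + snd p * H p) = 0"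
    if G: "G \<in> rudin_submodule" and H: "H \<in> rudin_submodule" for G H
  proof -
    let ?g = "taylor_coeff G" and ?h = "taylor_coeff H"
    let ?q = "\<lambda>k. shift1 ?g k + shift2 ?h k"
    have Gg: "hardy_series ?g G" and Hh: "hardy_series ?h H"
      using G H by (simp_all add: rudin_submodule_hardy_series)
    have rG: "row ?g k \<in> rudin_space k" and rH: "row ?h k \<in> rudin_space k" for k
      using G H by (simp_all add: rudin_submodule_iff[OF Gg] rudin_submodule_iff[OF Hh])
    have q: "hardy_series ?q (\<lambda>p. fst p * G p + snd p * H p)"
      by (intro hardy_series_add hardy_series_shift1 hardy_series_shift2 Gg Hh)
    have "((\<lambda>k. row_coeffs 0 A k * cnj (?q k) + row_coeffs 1 B k * cnj (?q k))
        has_sum h2_inner A (row ?q 0) + h2_inner B (row ?q 1)) UNIV"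
      by (intro has_sum_add row_fun_inner_has_sum[OF A q] row_fun_inner_has_sum[OF B q])
    then have "hardy_inner F (\<lambda>p. fst p * G p + snd p * H p) = h2_inner A (row ?q 0) + h2_inner B (row ?q 1)"
      unfolding hardy_inner_def taylor_coeff_hardy_series[OF Fb] taylor_coeff_hardy_series[OF q]
      by (intro infsumI) (simp add: distrib_right)
    also have "row ?q 0 = fps_X * row ?h 0"
      by (simp add: row_add row_shift1 row_shift2)
    also have "h2_inner A (fps_X * row ?h 0) = 0"
      using rudin.product_orthogonal[OF rH[of 0]] rH[of 0]
      by (simp add: A_def h2_inner_cmult_left rudin.product_h2 h2_X_mult_iff zero_space_h2)
    also have "row ?q 1 = row ?g 0 + fps_X * row ?h 1"
      by (simp add: row_add row_shift1 row_shift2)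
    also have "h2_inner B (row ?g 0 + fps_X * row ?h 1) = 0"
    proof -
      obtain C where C: "C \<in> rudin_space 1" "row ?g 0 = fps_X * C"
        using rudin_space_0_divide[OF rG[of 0]] .
      then show ?thesis
        using rudin.product_orthogonal[OF rH[of 1]] rudin.product_orthogonal[OF C(1)] rH[of 1]
        by (simp add: B_def h2_inner_cmult_left h2_inner_add_right rudin.product_h2 h2_cmult h2_add
            h2_X_mult_iff zero_space_h2)
    qed
    finally show ?thesis
      by simp
  qed
  ultimately show "F \<in> wandering rudin_submodule"
    by (simp add: wandering_def)
qed

theorem corollary3p2:
  shows "wandering rudin_submodule =
           {fun_scale c rudin_gen0 + fun_scale d rudin_gen1 | c d. True} \<and>
         hardy_inner rudin_gen0 rudin_gen1 = 0 \<and>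
         cfun.dim (wandering rudin_submodule) = 2"
proof (intro conjI)
  let ?g0 = "rudin_gen0" and ?g1 = "rudin_gen1"
  show W: "wandering rudin_submodule = {fun_scale c ?g0 + fun_scale d ?g1 | c d. True}"
    by (simp add: set_eq_iff wandering_rudin_submodule_iff)
  have g0: "hardy_series (row_coeffs 0 (rudin_phi 0)) ?g0"
    unfolding rudin_gen0_eq by (intro hardy_series_row_fun rudin.product_h2)
  show "hardy_inner ?g0 ?g1 = 0"
    unfolding rudin_gen1_eq hardy_inner_row_fun_right[OF g0 rudin.product_h2]
    by (simp add: row_row_coeffs h2_inner_def)
  \<comment> \<open>The generators live in different rows, so comparing row \<open>0\<close> suffices.\<close>
  have ne: "?g0 \<noteq> fun_scale c ?g1" for c
  proof
    assume "?g0 = fun_scale c ?g1"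
    moreover have "hardy_series (row_coeffs 1 (fps_const c * rudin_phi 1)) (fun_scale c ?g1)"
      unfolding rudin_gen1_eq scale_row_fun[OF rudin.product_h2]
      by (intro hardy_series_row_fun h2_cmult rudin.product_h2)
    ultimately have "row_coeffs 0 (rudin_phi 0) = row_coeffs 1 (fps_const c * rudin_phi 1)"
      using taylor_coeff_hardy_series g0 by metis
    then have "row (row_coeffs 0 (rudin_phi 0)) 0 = row (row_coeffs 1 (fps_const c * rudin_phi 1)) 0"
      by simp
    then show False
      using rudin.product_nonzero[of 0] by (simp add: row_row_coeffs)
  qed
  have g1: "?g1 \<noteq> 0"
  proof
    assume "?g1 = 0"
    moreover have "hardy_series (row_coeffs 1 (rudin_phi 1)) ?g1"
      unfolding rudin_gen1_eq by (intro hardy_series_row_fun rudin.product_h2)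
    moreover have "hardy_series (row_coeffs 1 0) (0 :: complex \<times> complex \<Rightarrow> complex)"
    proof -
      have "(0 :: complex \<times> complex \<Rightarrow> complex) = row_fun 1 0"
        by (simp add: fun_eq_iff)
      then show ?thesis
        using hardy_series_row_fun[of 0 1] by simp
    qed
    ultimately have "row_coeffs 1 (rudin_phi 1) = row_coeffs 1 0"
      using taylor_coeff_hardy_series by metis
    then have "row (row_coeffs 1 (rudin_phi 1)) 1 = row (row_coeffs 1 0) 1"
      by simp
    then show False
      using rudin.product_nonzero[of 1] by (simp add: row_row_coeffs)
  qed
  have notin: "?g0 \<notin> cfun.span {?g1}"
    using ne by (auto simp: cfun.span_singleton)
  then have "?g0 \<noteq> ?g1"
    using cfun.span_base[of ?g1 "{?g1}"] by auto
  have "cfun.independent {?g0, ?g1}"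
    using notin g1 by (simp add: cfun.independent_insert)
  then have "cfun.dim (cfun.span {?g0, ?g1}) = card {?g0, ?g1}"
    by (rule cfun.dim_span_eq_card_independent)
  moreover have "cfun.span {?g0, ?g1} = wandering rudin_submodule"
  proof -
    have "F \<in> cfun.span {?g0, ?g1} \<longleftrightarrow> (\<exists>c d. F - fun_scale c ?g0 = fun_scale d ?g1)" for F
      by (simp add: cfun.span_insert[of ?g0 "{?g1}"] cfun.span_singleton image_iff)
    then show ?thesis
      by (simp add: W set_eq_iff diff_eq_eq add.commute)
  qed
  ultimately show "cfun.dim (wandering rudin_submodule) = 2"
    using \<open>?g0 \<noteq> ?g1\<close> by simp
qed

end
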